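(* Let $A_0(z),\dots,A_n(z)$ be entire functions such that there exists an integer $\ell$, $0\le\ell\le n$, with $$\sigma(A_\ell)>\max_{\substack{0\le j\le n\\ j\ne\ell}}\sigma(A_j).$$ If $f\not\equiv0$ is a meromorphic function on $\mathbb{C}$ satisfying $$A_n(z)f(z+n)+\cdots+A_1(z)f(z+1)+A_0(z)f(z)=0,$$ then $\sigma(f)\ge\sigma(A_\ell)+1$.
   Context: Meromorphic means meromorphic in the whole complex plane. $\sigma(g)$ denotes the order of growth of a meromorphic function $g$: $\sigma(g)=\limsup_{r\to\infty}\frac{\log^+T(r,g)}{\log r}\in[0,\infty]$, where $T(r,g)=m(r,g)+N(r,g)$ is the Nevanlinna characteristic, with $m(r,g)=\frac1{2\pi}\int_0^{2\pi}\log^+|g(re^{i\theta})|\,d\theta$, $N(r,g)=\int_0^r\frac{n(t,g)-n(0,g)}{t}\,dt+n(0,g)\log r$, and $n(t,g)$ the number of poles of $g$ in $|z|\le t$ with multiplicity. *)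

theory Defs
  imports "HOL-Complex_Analysis.Complex_Analysis"
begin

text \<open>
  Meromorphic functions are library-style: total functions \<open>f\<close> with \<open>f meromorphic_on UNIV\<close>, whose
  values on a sparse set of points (in particular at poles) are arbitrary.  Everything below is
  insensitive to these values.
\<close>

text \<open>Written with \<open>max 1\<close> inside so that \<open>log_plus x = 0\<close> for all \<open>x \<le> 1\<close>, including \<open>x \<le> 0\<close>.\<close>

definition log_plus :: "real \<Rightarrow> real" where
  "log_plus x = ln (max 1 x)"

definition proximity :: "real \<Rightarrow> (complex \<Rightarrow> complex) \<Rightarrow> real" where
  "proximity r g =
     1 / (2 * pi) * integral {0..2 * pi} (\<lambda>\<theta>. log_plus (norm (g (of_real r * exp (\<i> * of_real \<theta>)))))"

text \<open>At a pole, \<open>zorder\<close> is negative and its absolute value is the multiplicity of the pole.\<close>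

definition pole_count :: "real \<Rightarrow> (complex \<Rightarrow> complex) \<Rightarrow> nat" where
  "pole_count t g = (\<Sum>z | norm z \<le> t \<and> is_pole g z. nat (- zorder g z))"

definition pole_counting :: "real \<Rightarrow> (complex \<Rightarrow> complex) \<Rightarrow> real" where
  "pole_counting r g =
     integral {0..r} (\<lambda>t. (real (pole_count t g) - real (pole_count 0 g)) / t)
       + real (pole_count 0 g) * ln r"

definition nevanlinna_char :: "real \<Rightarrow> (complex \<Rightarrow> complex) \<Rightarrow> real" where
  "nevanlinna_char r g = proximity r g + pole_counting r g"

definition growth_order :: "(complex \<Rightarrow> complex) \<Rightarrow> ereal" where
  "growth_order g = Limsup at_top (\<lambda>r::real. ereal (log_plus (nevanlinna_char r g) / ln r))"

end

theory Submission
  imports Defs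
begin

text \<open>
  On a disc of radius \<open>R\<close> whose boundary avoids zeros and poles, write \<open>f\<close> as a product of Blaschke
  factors times \<open>exp G\<close>. The mean value property of \<open>G\<close> is Jensen's formula; it bounds both the mean
  of \<open>\<bar>Re G\<bar>\<close> and the number of zeros and poles by \<open>T(R,f) = O(R\<^sup>s)\<close>, \<open>s > \<sigma>(f)\<close>. Compare \<open>ln \<bar>f(z+u)\<bar>\<close>
  and \<open>ln \<bar>f(z+v)\<bar>\<close> on \<open>\<bar>z\<bar> = r\<close>, with \<open>R\<close> about \<open>4 r\<close>: the derivative of \<open>G\<close> is
  \<open>O(R\<^sup>s / R)\<close>, and each zero or pole \<open>a\<close> contributes logarithms \<open>ln (1 + d / \<bar>z - a\<bar>)\<close>, whose circular
  mean is \<open>O(1/r\<^sup>\<alpha>)\<close> for every \<open>\<alpha> < 1\<close>. Hence \<open>\<bar>ln \<bar>f(z+u) / f(z+v)\<bar>\<bar>\<close> has mean \<open>O(r powr (s - \<alpha>))\<close>. Solving the equation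
  for \<open>A\<^sub>l\<close> bounds \<open>T(r,A\<^sub>l)\<close> by the \<open>T(r,A\<^sub>j)\<close>, \<open>j \<noteq> l\<close>, plus such terms, so that
  \<open>\<sigma>(A\<^sub>l) \<le> \<sigma>(f) - 1\<close>. All estimates are made at radii outside a countable set, which spares every
  convergence question for integrals with singularities on the circle.
\<close>

section \<open>Means over circles\<close>

text \<open>The gauge integral of a non-integrable function is 0, so the additivity and comparison
  rules below ask for continuity on the circle, which generic radii will provide.\<close>

definition circle_mean :: "real \<Rightarrow> (complex \<Rightarrow> real) \<Rightarrow> real" where
  "circle_mean r u = 1 / (2 * pi) * integral {0..2 * pi} (\<lambda>t. u (of_real r * cis t))"

lemma proximity_eq_circle_mean: "proximity r g = circle_mean r (\<lambda>z. log_plus (norm (g z)))"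
  by (simp add: proximity_def circle_mean_def cis_conv_exp)

lemma circle_integrable:
  fixes u :: "complex \<Rightarrow> 'a::banach"
  assumes "continuous_on (sphere 0 r) u" "r \<ge> 0"
  shows "(\<lambda>t. u (of_real r * cis t)) integrable_on {a..b}"
  by (rule integrable_continuous_interval, rule continuous_on_compose2[OF assms(1)])
     (use assms(2) in \<open>auto intro!: continuous_intros simp: norm_mult\<close>)

lemma circle_mean_cong:
  assumes "\<And>z. norm z = r \<Longrightarrow> u z = v z" "r \<ge> 0"
  shows "circle_mean r u = circle_mean r v"
  unfolding circle_mean_def using assms
  by (intro arg_cong[where f = "\<lambda>x. 1 / (2 * pi) * x"] integral_cong) (auto simp: norm_mult)

lemma circle_mean_mono:
  assumes "continuous_on (sphere 0 r) u" "continuous_on (sphere 0 r) v" "r \<ge> 0"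
    and "\<And>z. norm z = r \<Longrightarrow> u z \<le> v z"
  shows "circle_mean r u \<le> circle_mean r v"
  unfolding circle_mean_def using assms
  by (intro mult_left_mono integral_le circle_integrable) (auto simp: norm_mult)

lemma circle_mean_add:
  assumes "continuous_on (sphere 0 r) u" "continuous_on (sphere 0 r) v" "r \<ge> 0"
  shows "circle_mean r (\<lambda>z. u z + v z) = circle_mean r u + circle_mean r v"
  unfolding circle_mean_def
  by (subst integral_add) (use assms in \<open>auto intro!: circle_integrable simp: distrib_left\<close>)

lemma circle_mean_diff:
  assumes "continuous_on (sphere 0 r) u" "continuous_on (sphere 0 r) v" "r \<ge> 0"
  shows "circle_mean r (\<lambda>z. u z - v z) = circle_mean r u - circle_mean r v"
  unfolding circle_mean_def
  by (subst integral_diff) (use assms in \<open>auto intro!: circle_integrable simp: right_diff_distrib\<close>)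

lemma circle_mean_cmult: "circle_mean r (\<lambda>z. c * u z) = c * circle_mean r u"
  unfolding circle_mean_def by simp

lemma circle_mean_const [simp]: "circle_mean r (\<lambda>z. c) = c"
  by (simp add: circle_mean_def)

lemma circle_mean_sum:
  assumes "finite I" "\<And>i. i \<in> I \<Longrightarrow> continuous_on (sphere 0 r) (u i)" "r \<ge> 0"
  shows "circle_mean r (\<lambda>z. \<Sum>i\<in>I. u i z) = (\<Sum>i\<in>I. circle_mean r (u i))"
  unfolding circle_mean_def
  by (subst integral_sum) (use assms in \<open>auto intro!: circle_integrable simp: sum_distrib_left\<close>)

text \<open>If the integrand is not integrable, its integral has the default value 0, so the bound
  holds in that case too.\<close>

lemma circle_mean_nonneg:
  assumes "\<And>z. norm z = r \<Longrightarrow> u z \<ge> 0" "r \<ge> 0"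
  shows "circle_mean r u \<ge> 0"
proof (cases "(\<lambda>t. u (of_real r * cis t)) integrable_on {0..2 * pi}")
  case True
  have "integral {0..2 * pi} (\<lambda>t. u (of_real r * cis t)) \<ge> 0"
    using assms by (intro integral_nonneg True) (auto simp: norm_mult)
  thus ?thesis by (simp add: circle_mean_def)
qed (simp add: circle_mean_def not_integrable_integral)

text \<open>With \<open>z = r * cis t\<close> one has \<open>dz = \<i> * z * dt\<close>. Writing the
  value as \<open>\<i> * I\<close> cancels the imaginary unit and leaves an ordinary integral over
  \<open>t\<close>.\<close>

lemma has_contour_integral_circlepath_0_iff:
  "(F has_contour_integral \<i> * I) (circlepath 0 r) \<longleftrightarrow>
     ((\<lambda>t. F (of_real r * cis t) * (of_real r * cis t)) has_integral I) {0..2 * pi}"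
proof -
  have "(F has_contour_integral \<i> * I) (circlepath 0 r) \<longleftrightarrow>
     ((\<lambda>t. F (of_real r * cis t) * of_real r * \<i> * cis t) has_integral \<i> * I) {0..2 * pi}"
    unfolding circlepath_def by (subst has_contour_integral_part_circlepath_iff) auto
  also have "\<dots> \<longleftrightarrow> ((\<lambda>t. \<i> * (F (of_real r * cis t) * (of_real r * cis t))) has_integral \<i> * I) {0..2 * pi}"
    by (simp add: algebra_simps)
  also have "\<dots> \<longleftrightarrow> ((\<lambda>t. F (of_real r * cis t) * (of_real r * cis t)) has_integral I) {0..2 * pi}"
    by (subst has_integral_mult_right_iff) auto
  finally show ?thesis .
qed

text \<open>The mean value property: in Cauchy's formula at the centre, the factor \<open>z\<close>
  from \<open>dz\<close> cancels the denominator.\<close>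

lemma circle_mean_Re_holomorphic:
  assumes "continuous_on (cball 0 r) G" "G holomorphic_on ball 0 r" "r > 0"
  shows "circle_mean r (\<lambda>z. Re (G z)) = Re (G 0)"
proof -
  have "((\<lambda>u. G u / (u - 0)) has_contour_integral (2 * of_real pi * \<i> * G 0)) (circlepath 0 r)"
    using assms by (intro Cauchy_integral_circlepath) auto
  hence "((\<lambda>u. G u / (u - 0)) has_contour_integral \<i> * (2 * of_real pi * G 0)) (circlepath 0 r)"
    by (simp add: mult_ac)
  hence "((\<lambda>t. G (of_real r * cis t)) has_integral (2 * of_real pi * G 0)) {0..2 * pi}"
    unfolding has_contour_integral_circlepath_0_iff using assms(3) by simp
  hence "((\<lambda>t. Re (G (of_real r * cis t))) has_integral Re (2 * of_real pi * G 0)) {0..2 * pi}"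
    by (rule has_integral_Re)
  thus ?thesis unfolding circle_mean_def by (simp add: integral_unique)
qed

text \<open>The Cauchy formula for the derivative, in which the conjugate of \<open>G\<close> may be added for free:
  on the circle it is integrated against a kernel conjugate to a holomorphic function.\<close>

lemma norm_deriv_le_circle_mean:
  assumes "continuous_on (cball 0 r) G" "G holomorphic_on ball 0 r" "r > 0" "norm z \<le> r / 2"
  shows "norm (deriv G z) \<le> 8 / r * circle_mean r (\<lambda>z. \<bar>Re (G z)\<bar>)"
proof -
  define w where "w = (\<lambda>t. complex_of_real r * cis t)"
  have nw: "norm (w t) = r" for t using assms(3) by (simp add: w_def norm_mult)
  have wz: "w t \<noteq> z" for t using nw[of t] assms by auto
  have "((\<lambda>u. G u / (u - z) ^ Suc 1) has_contour_integral ((2 * pi * \<i>) / (fact 1) * (deriv ^^ 1) G z)) (circlepath 0 r)"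
    using assms by (intro Cauchy_has_contour_integral_higher_derivative_circlepath) auto
  hence "((\<lambda>u. G u / (u - z)\<^sup>2) has_contour_integral \<i> * (2 * pi * deriv G z)) (circlepath 0 r)"
    by (simp add: mult_ac power2_eq_square)
  hence 1: "((\<lambda>t. G (w t) / (w t - z)^2 * w t) has_integral (2 * pi * deriv G z)) {0..2 * pi}"
    by (simp only: has_contour_integral_circlepath_0_iff w_def)
  \<comment> \<open>For nonzero \<open>z\<close> the zero of this expression is the reflection of
    \<open>z\<close> in the circle, of modulus at least \<open>2 * r\<close>, so the kernel below
    has no pole in the closed disc.\<close>
  have nz: "of_real (r\<^sup>2) - cnj z * u \<noteq> 0" if "norm u \<le> r" for u
  proof
    assume "of_real (r\<^sup>2) - cnj z * u = 0"
    hence "norm (cnj z * u) = r\<^sup>2" by (metis abs_of_nonneg eq_iff_diff_eq_0 norm_of_real zero_le_power2)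
    moreover have "norm (cnj z * u) \<le> (r / 2) * r"
      unfolding norm_mult using that assms by (intro mult_mono) auto
    ultimately show False using assms(3) by (simp add: power2_eq_square)
  qed
  \<comment> \<open>This kernel is chosen so that on the circle, where \<open>w * cnj w\<close> is
    the squared radius, its conjugate is again \<open>w / (w - z)^2\<close>. Cauchy's theorem makes
    the integral vanish.\<close>
  have "((\<lambda>u. G u * of_real (r\<^sup>2) / (of_real (r\<^sup>2) - cnj z * u)\<^sup>2) has_contour_integral \<i> * 0) (circlepath 0 r)"
    unfolding mult_zero_right
  proof (rule Cauchy_theorem_disc[where K = "{}" and a = 0 and e = r])
    show "continuous_on (cball 0 r) (\<lambda>u. G u * of_real (r\<^sup>2) / (of_real (r\<^sup>2) - cnj z * u)\<^sup>2)"
      using nz by (intro continuous_intros assms(1)) auto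
    have "(\<lambda>u. G u * of_real (r\<^sup>2) / (of_real (r\<^sup>2) - cnj z * u)\<^sup>2) holomorphic_on ball 0 r"
      using nz by (intro holomorphic_intros assms(2)) auto
    thus "\<And>x. x \<in> ball 0 r - {} \<Longrightarrow> (\<lambda>u. G u * of_real (r\<^sup>2) / (of_real (r\<^sup>2) - cnj z * u)\<^sup>2) field_differentiable at x"
      by (simp add: holomorphic_on_imp_differentiable_at)
  qed (use assms in auto)
  hence "((\<lambda>t. G (w t) * of_real (r\<^sup>2) / (of_real (r\<^sup>2) - cnj z * w t)\<^sup>2 * w t) has_integral 0) {0..2 * pi}"
    by (simp only: has_contour_integral_circlepath_0_iff w_def)
  hence "((\<lambda>t. cnj (G (w t) * of_real (r\<^sup>2) / (of_real (r\<^sup>2) - cnj z * w t)\<^sup>2 * w t)) has_integral cnj 0) {0..2 * pi}"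
    by (rule has_integral_linear[OF _ bounded_linear_cnj, unfolded o_def])
  moreover have "cnj (G (w t) * of_real (r\<^sup>2) / (of_real (r\<^sup>2) - cnj z * w t)\<^sup>2 * w t)
      = cnj (G (w t)) / (w t - z)^2 * w t" for t
  proof -
    have ww: "of_real (r\<^sup>2) = w t * cnj (w t)"
      using complex_norm_square[of "w t"] nw[of t] by simp
    have 0: "w t \<noteq> 0" using nw[of t] assms(3) by auto
    have "cnj (G (w t) * of_real (r\<^sup>2) / (of_real (r\<^sup>2) - cnj z * w t)\<^sup>2 * w t)
      = cnj (G (w t)) * (w t * cnj (w t)) / (cnj (w t) * (w t - z))\<^sup>2 * cnj (w t)"
      unfolding ww by (simp add: algebra_simps)
    also have "\<dots> = cnj (G (w t)) * w t * ((cnj (w t))\<^sup>2 / ((cnj (w t))\<^sup>2 * (w t - z)\<^sup>2))"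
      by (simp add: power_mult_distrib power2_eq_square mult_ac)
    also have "\<dots> = cnj (G (w t)) / (w t - z)^2 * w t"
      using 0 by simp
    finally show ?thesis .
  qed
  ultimately have 2: "((\<lambda>t. cnj (G (w t)) / (w t - z)^2 * w t) has_integral 0) {0..2 * pi}"
    by simp
  \<comment> \<open>Adding the two integrals replaces \<open>G\<close> by \<open>G + cnj G\<close>,
    twice its real part.\<close>
  have "((\<lambda>t. 2 * of_real (Re (G (w t))) / (w t - z)^2 * w t) has_integral (2 * pi * deriv G z)) {0..2 * pi}"
    using has_integral_add[OF 1 2] 
    by (simp add: complex_add_cnj flip: distrib_right add_divide_distrib)
  from has_integral_mult_right[OF this, of "1/2"]
  have 3: "((\<lambda>t. of_real (Re (G (w t))) / (w t - z)^2 * w t) has_integral (pi * deriv G z)) {0..2 * pi}"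
    by (simp add: mult.assoc)
  have ci: "(\<lambda>t. \<bar>Re (G (w t))\<bar>) integrable_on {0..2 * pi}"
    unfolding w_def using assms
    by (intro circle_integrable continuous_intros) (auto intro: continuous_on_subset)
  \<comment> \<open>From \<open>norm (w t - z) \<ge> r / 2\<close> the kernel is at most
    \<open>4 / r\<close>. Passing from the integral divided by \<open>pi\<close> to the mean doubles
    this to \<open>8 / r\<close>.\<close>
  have "norm (pi * deriv G z) \<le> integral {0..2*pi} (\<lambda>t. 4 / r * \<bar>Re (G (w t))\<bar>)"
    unfolding integral_unique[OF 3, symmetric]
  proof (rule integral_norm_bound_integral)
    fix t
    have "norm (w t - z) \<ge> r / 2" using norm_triangle_ineq2[of "w t" z] nw[of t] assms by simp
    hence "norm (w t - z)^2 \<ge> (r / 2)^2" using assms by (intro power_mono) auto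
    hence "r / (norm (w t - z))^2 \<le> r / (r / 2)^2" using assms wz[of t] by (intro divide_left_mono mult_pos_pos) auto
    also have "\<dots> = 4 / r" using assms by (simp add: power2_eq_square field_simps)
    finally have "r / (norm (w t - z))^2 \<le> 4 / r" .
    from mult_right_mono[OF this, of "\<bar>Re (G (w t))\<bar>"]
    show "norm (of_real (Re (G (w t))) / (w t - z)^2 * w t) \<le> 4 / r * \<bar>Re (G (w t))\<bar>"
      by (simp add: norm_mult norm_divide norm_power nw mult_ac)
  qed (use 3 integrable_on_mult_right[OF ci, of "4 / r"] in auto)
  hence "norm (deriv G z) * pi \<le> 4 / r * integral {0..2*pi} (\<lambda>t. \<bar>Re (G (w t))\<bar>)"
    by (simp add: norm_mult mult.commute)
  hence "norm (deriv G z) \<le> 4 / r * integral {0..2*pi} (\<lambda>t. \<bar>Re (G (w t))\<bar>) / pi"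
    by (subst pos_le_divide_eq) auto
  thus ?thesis
    by (simp add: circle_mean_def w_def mult_ac)
qed

section \<open>Circular means of logarithmic kernels\<close>

text \<open>Take logarithms in the subadditivity
  \<open>(1 + x) powr \<alpha> \<le> 1 + x powr \<alpha>\<close>. The bound trades a logarithmic
  singularity for a power that is integrable when \<open>\<alpha> < 1\<close>.\<close>

lemma ln_one_plus_le_powr:
  fixes x \<alpha> :: real
  assumes "x \<ge> 0" "0 < \<alpha>" "\<alpha> \<le> 1"
  shows "ln (1 + x) \<le> x powr \<alpha> / \<alpha>"
proof -
  have sub: "t \<le> t powr \<alpha>" if "0 \<le> t" "t \<le> 1" for t :: real
    using that assms powr_mono'[of \<alpha> 1 t] by (cases "t = 0") auto
  \<comment> \<open>Subadditivity: two numbers in the unit interval sum to 1, and the exponent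
    \<open>\<alpha> \<le> 1\<close> can only increase each.\<close>
  have "1 = 1 / (1 + x) + x / (1 + x)" using assms(1) by (simp add: field_simps)
  also have "\<dots> \<le> (1 / (1 + x)) powr \<alpha> + (x / (1 + x)) powr \<alpha>"
    using assms(1) by (intro add_mono sub) auto
  also have "\<dots> = (1 + x powr \<alpha>) / (1 + x) powr \<alpha>"
    using assms(1) by (simp add: powr_divide add_divide_distrib)
  finally have "(1 + x) powr \<alpha> \<le> 1 + x powr \<alpha>"
    using assms(1) by (simp add: field_simps)
  hence "ln ((1 + x) powr \<alpha>) \<le> ln (1 + x powr \<alpha>)"
    using assms(1) by (subst ln_le_cancel_iff) (auto intro: add_pos_nonneg)
  also have "\<dots> \<le> x powr \<alpha>" by (intro ln_add_one_self_le_self) auto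
  finally have "\<alpha> * ln (1 + x) \<le> x powr \<alpha>" using assms(1) by (simp add: ln_powr)
  thus ?thesis using assms(2) by (simp add: pos_le_divide_eq mult.commute)
qed

text \<open>For angles up to \<open>pi / 2\<close> the imaginary part and Jordan's inequality
  \<open>sin y \<ge> 2 / pi * y\<close> suffice. For larger angles the two points lie on opposite
  sides of the imaginary axis, so their distance is at least \<open>r\<close>.\<close>

lemma norm_cis_diff_ge:
  assumes "r \<ge> 0" "s \<ge> 0" "\<bar>x\<bar> \<le> pi"
  shows "norm (of_real r * cis x - of_real s) \<ge> r / pi * \<bar>x\<bar>"
proof (cases "\<bar>x\<bar> \<le> pi / 2")
  case True
  have *: "2 / pi * y \<le> sin y" if "0 \<le> y" "y \<le> pi / 2" for y
  proof -
    have "convex_on {0..pi/2} (\<lambda>x. - sin x)"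
      by (rule f''_ge0_imp_convex[where f' = "\<lambda>x. - cos x" and f'' = sin])
         (auto intro!: derivative_eq_intros sin_ge_zero)
    from convex_onD[OF this, of "2 * y / pi" 0 "pi / 2"] that
    have "- sin (2 * y / pi * (pi / 2)) \<le> - (2 * y / pi)" by simp
    moreover have "2 * y / pi * (pi / 2) = y" by simp
    ultimately show ?thesis by simp
  qed
  have "r / pi * \<bar>x\<bar> \<le> r * (2 / pi * \<bar>x\<bar>)"
    using mult_right_mono[of 1 2 "r / pi * \<bar>x\<bar>"] assms(1) by simp
  also have "\<dots> \<le> r * sin \<bar>x\<bar>" using True assms(1) by (intro mult_left_mono *) auto
  also have "\<dots> \<le> \<bar>r * sin x\<bar>" by (cases "x \<ge> 0") auto
  also have "\<dots> = \<bar>Im (of_real r * cis x - of_real s)\<bar>" by simp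
  also have "\<dots> \<le> norm (of_real r * cis x - of_real s)" by (rule abs_Im_le_cmod)
  finally show ?thesis .
next
  case False
  have "cos (pi - \<bar>x\<bar>) \<ge> 0" using False assms(3) by (intro cos_ge_zero) auto
  hence c: "cos x \<le> 0" by simp
  have "r\<^sup>2 = (r * cos x)\<^sup>2 + (r * sin x)\<^sup>2"
    by (simp add: power_mult_distrib flip: distrib_left)
  also have "(r * cos x)\<^sup>2 \<le> (r * cos x - s)\<^sup>2"
    using mult_nonneg_nonpos[OF assms(1) c] assms(2) by (intro abs_le_square_iff[THEN iffD1]) linarith
  finally have "r\<^sup>2 \<le> (r * cos x - s)\<^sup>2 + (r * sin x)\<^sup>2" by simp
  hence "r \<le> norm (of_real r * cis x - of_real s)"
    by (simp add: cmod_def real_le_rsqrt)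
  moreover have "r / pi * \<bar>x\<bar> \<le> r" 
    using mult_left_mono[OF assms(3), of "r / pi"] assms(1) by simp
  ultimately show ?thesis by simp
qed

text \<open>The bound is uniform in \<open>c\<close>: the interval of integration is enlarged to one
  of radius \<open>6 * pi\<close> about \<open>c\<close>, where the integral is explicit.\<close>

lemma integral_abs_powr_le:
  fixes \<alpha> c :: real
  assumes "0 < \<alpha>" "\<alpha> < 1" "\<bar>c\<bar> \<le> 4 * pi"
  shows "(\<lambda>t. \<bar>t - c\<bar> powr (- \<alpha>)) integrable_on {0..2 * pi}" (is ?A)
    and "integral {0..2 * pi} (\<lambda>t. \<bar>t - c\<bar> powr (- \<alpha>)) \<le> 2 * ((6 * pi) powr (1 - \<alpha>) / (1 - \<alpha>))" (is ?B)
proof -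
  define K where "K = (6 * pi) powr (1 - \<alpha>) / (1 - \<alpha>)"
  have 1: "((\<lambda>x. x powr (- \<alpha>)) has_integral K) {0..6 * pi}"
    using has_integral_powr_from_0[of "-\<alpha>" "6 * pi"] assms by (simp add: K_def)
  hence 2: "((\<lambda>x. \<bar>x\<bar> powr (- \<alpha>)) has_integral K) {0..6 * pi}"
    by (rule has_integral_eq[rotated]) auto
  have 3: "((\<lambda>x. \<bar>x\<bar> powr (- \<alpha>)) has_integral K) {-(6 * pi)..0}"
    using has_integral_reflect_lemma_real[OF 2] by simp
  have "((\<lambda>x. \<bar>x\<bar> powr (- \<alpha>)) has_integral K + K) {-(6 * pi)..6 * pi}"
    by (rule has_integral_combine[OF _ _ 3 2]) auto
  from has_integral_shift_real_ivl[OF this, of "-c"]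
  have 4: "((\<lambda>x. \<bar>x - c\<bar> powr (- \<alpha>)) has_integral 2 * K) {c - 6 * pi..c + 6 * pi}"
    by (simp add: algebra_simps)
  have sub: "{0..2 * pi} \<subseteq> {c - 6 * pi..c + 6 * pi}" using assms by auto
  show ?A using integrable_on_subinterval[OF has_integral_integrable[OF 4] sub] .
  hence "integral {0..2 * pi} (\<lambda>t. \<bar>t - c\<bar> powr (- \<alpha>)) \<le> integral {c - 6 * pi..c + 6 * pi} (\<lambda>t. \<bar>t - c\<bar> powr (- \<alpha>))"
    using has_integral_integrable[OF 4] sub by (intro integral_subset_le) auto
  also have "\<dots> = 2 * K" using 4 by (rule integral_unique)
  finally show ?B by (simp add: K_def)
qed

text \<open>Two singularities on the parameter interval, each contributing twice a one-sided
  integral, give the factor 4; \<open>1 / \<alpha>\<close> comes from the power bound for the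
  logarithm.\<close>

definition log_mean_const :: "real \<Rightarrow> real" where
  "log_mean_const \<alpha> = 4 * ((6 * pi) powr (1 - \<alpha>) / (1 - \<alpha>)) / \<alpha>"

lemma log_mean_const_nonneg: "0 < \<alpha> \<Longrightarrow> \<alpha> < 1 \<Longrightarrow> log_mean_const \<alpha> \<ge> 0"
  by (simp add: log_mean_const_def)

lemma continuous_on_log_quotient:
  fixes a :: complex
  assumes "d \<ge> 0" "a \<notin> S"
  shows "continuous_on S (\<lambda>z. ln (1 + d / norm (z - a)))"
proof (intro continuous_intros ballI)
  fix z assume "z \<in> S"
  thus "norm (z - a) \<noteq> 0" using assms(2) by auto
  have "1 + d / norm (z - a) > 0" using assms(1) by (intro add_pos_nonneg) auto
  thus "1 + d / norm (z - a) \<noteq> 0" by linarith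
qed

text \<open>The distance from the circle point at angle \<open>x\<close> from \<open>a\<close> is at
  least \<open>r / pi * \<bar>x\<bar>\<close>, so the logarithm is bounded by a multiple of
  \<open>\<bar>x\<bar> powr (- \<alpha>)\<close>. The bound does not depend on \<open>a\<close>,
  however close \<open>a\<close> is to the circle.\<close>

lemma circle_mean_log_le:
  assumes "0 < \<alpha>" "\<alpha> < 1" "r > 0" "d \<ge> 0" "norm a \<noteq> r"
  shows "circle_mean r (\<lambda>z. ln (1 + d / norm (z - a))) \<le> log_mean_const \<alpha> * (pi * d / r) powr \<alpha>"
proof -
  define b where "b = Arg a"
  have b: "- pi < b" "b \<le> pi" using Arg_bounded[of a] by (auto simp: b_def)
  have a: "a = of_real (norm a) * cis b"
    using rcis_cmod_Arg[of a] by (simp add: rcis_def b_def)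
  define D where "D = (pi * d / r) powr \<alpha> / \<alpha>"
  have D: "D \<ge> 0" using assms by (simp add: D_def)
  define K where "K = 2 * ((6 * pi) powr (1 - \<alpha>) / (1 - \<alpha>))"
  \<comment> \<open>As \<open>t\<close> runs through the parameter interval, \<open>t - b\<close>
    lies between \<open>- pi\<close> and \<open>3 * pi\<close>. The angle reduced to modulus at most
    \<open>pi\<close> is therefore \<open>t - b\<close> or \<open>t - b - 2 * pi\<close>, and
    \<open>h\<close> adds the bounds for both.\<close>
  define h where "h = (\<lambda>t. D * (\<bar>t - b\<bar> powr (- \<alpha>) + \<bar>t - (b + 2 * pi)\<bar> powr (- \<alpha>)))"
  have hi: "h integrable_on {0..2 * pi}" unfolding h_def using b assms
    by (intro integrable_on_mult_right integrable_add integral_abs_powr_le(1)) auto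
  have hI: "integral {0..2 * pi} h \<le> D * (K + K)"
  proof -
    have "integral {0..2 * pi} h = D * (integral {0..2 * pi} (\<lambda>t. \<bar>t - b\<bar> powr (- \<alpha>))
        + integral {0..2 * pi} (\<lambda>t. \<bar>t - (b + 2 * pi)\<bar> powr (- \<alpha>)))"
      unfolding h_def integral_mult_right using b assms
      by (subst integral_add) (auto intro!: integral_abs_powr_le(1))
    also have "\<dots> \<le> D * (K + K)" unfolding K_def using b assms D
      by (intro mult_left_mono add_mono integral_abs_powr_le(2)) auto
    finally show ?thesis .
  qed
  have bd: "ln (1 + d / norm (of_real r * cis t - a)) \<le> D * \<bar>x\<bar> powr (- \<alpha>)" 
    if x: "\<bar>x\<bar> \<le> pi" "cis x = cis (t - b)" "x \<noteq> 0" for t x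
  proof -
    have "norm (of_real r * cis t - a) = norm (cis b * (of_real r * cis x - of_real (norm a)))"
    proof -
      have "cis b * (of_real r * cis x - of_real (norm a)) = of_real r * (cis b * cis x) - of_real (norm a) * cis b"
        by (simp add: algebra_simps)
      also have "\<dots> = of_real r * cis t - a" using a by (simp add: x(2) cis_mult)
      finally show ?thesis by simp
    qed
    hence ge: "norm (of_real r * cis t - a) \<ge> r / pi * \<bar>x\<bar>"
      using norm_cis_diff_ge[of r "norm a" x] x(1) assms(3) by (simp add: norm_mult)
    have pos: "norm (of_real r * cis t - a) > 0"
      using assms(3,5) by (auto simp: norm_mult)
    have "d / norm (of_real r * cis t - a) \<le> d / (r / pi * \<bar>x\<bar>)"
      using x assms ge pos by (intro divide_left_mono) auto
    hence "ln (1 + d / norm (of_real r * cis t - a)) \<le> ln (1 + d / (r / pi * \<bar>x\<bar>))"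
      using assms pos by (subst ln_le_cancel_iff) (auto intro!: add_pos_nonneg)
    also have "\<dots> \<le> (d / (r / pi * \<bar>x\<bar>)) powr \<alpha> / \<alpha>"
      using assms by (intro ln_one_plus_le_powr) auto
    also have "d / (r / pi * \<bar>x\<bar>) = (pi * d / r) * (1 / \<bar>x\<bar>)" by simp
    also have "\<dots> powr \<alpha> / \<alpha> = D * (1 / \<bar>x\<bar>) powr \<alpha>"
      using assms by (subst powr_mult) (auto simp: D_def)
    also have "\<dots> = D * \<bar>x\<bar> powr (- \<alpha>)"
      by (simp add: powr_minus powr_divide field_simps)
    finally show ?thesis .
  qed
  define u where "u = (\<lambda>t. ln (1 + d / norm (of_real r * cis t - a)))"
  \<comment> \<open>At the two singular parameters \<open>0 powr (- \<alpha>)\<close> is 0 rather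
    than infinite, so \<open>h\<close> need not dominate \<open>u\<close> there. Changing
    \<open>u\<close> on a finite set leaves its integral unchanged.\<close>
  define v where "v = (\<lambda>t. if t \<in> {b, b + 2 * pi} then 0 else u t)"
  have "continuous_on (sphere 0 r) (\<lambda>z. ln (1 + d / norm (z - a)))"
    using assms by (intro continuous_on_log_quotient) auto
  hence ui: "u integrable_on {0..2 * pi}"
    using circle_integrable[of r "\<lambda>z. ln (1 + d / norm (z - a))"] assms by (simp add: u_def)
  have "integral {0..2 * pi} u = integral {0..2 * pi} v"
    by (rule integral_spike[of "{b, b + 2 * pi}"]) (auto simp: v_def)
  also have "\<dots> \<le> integral {0..2 * pi} h"
  proof (rule integral_le)
    show "v integrable_on {0..2 * pi}"
      by (rule integrable_spike[OF ui, of "{b, b + 2 * pi}"]) (auto simp: v_def)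
    show "v t \<le> h t" if "t \<in> {0..2 * pi}" for t
    proof (cases "t \<in> {b, b + 2 * pi}")
      case True
      thus ?thesis using D by (auto simp: v_def h_def)
    next
      case t: False
      show ?thesis
      proof (cases "t - b \<le> pi")
        case True
        hence "u t \<le> D * \<bar>t - b\<bar> powr (- \<alpha>)"
          unfolding u_def using b that t by (intro bd) auto
        also have "\<dots> \<le> h t" using D by (simp add: h_def mult_left_mono)
        finally show ?thesis using t by (simp add: v_def)
      next
        case False
        hence "u t \<le> D * \<bar>t - (b + 2 * pi)\<bar> powr (- \<alpha>)"
          unfolding u_def using b that t
          by (intro bd) (auto simp: complex_eq_iff sin_diff cos_diff sin_add cos_add)
        also have "\<dots> \<le> h t" using D by (simp add: h_def mult_left_mono)
        finally show ?thesis using t by (simp add: v_def)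
      qed
    qed
  qed (fact hi)
  also have "\<dots> \<le> D * (K + K)" by (fact hI)
  finally have "integral {0..2 * pi} u \<le> D * (K + K)" .
  moreover have "D * (K + K) \<ge> 0" using D assms by (simp add: K_def)
  moreover have "1 / (2 * pi) \<le> 1" using pi_gt3 by simp
  ultimately have "1 / (2 * pi) * integral {0..2 * pi} u \<le> 1 / (2 * pi) * (D * (K + K))"
    "1 / (2 * pi) * (D * (K + K)) \<le> 1 * (D * (K + K))"
    by (intro mult_left_mono mult_right_mono; simp)+
  hence "circle_mean r (\<lambda>z. ln (1 + d / norm (z - a))) \<le> D * (K + K)"
    unfolding circle_mean_def u_def by simp
  thus ?thesis by (simp add: log_mean_const_def D_def K_def mult_ac)
qed

section \<open>The Poisson--Jensen formula\<close>

text \<open>The origin is included so that it can be treated like a zero or a pole, possibly of order 0.\<close>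

definition bad_points :: "(complex \<Rightarrow> complex) \<Rightarrow> complex set" where
  "bad_points f = insert 0 {z. \<not> (f analytic_on {z} \<and> f z \<noteq> 0)}"

lemma sparse_bad_points:
  assumes "f meromorphic_on UNIV" "\<not> (\<forall>\<^sub>\<approx>z\<in>UNIV. f z = 0)"
  shows "bad_points f sparse_in UNIV"
proof -
  have "\<forall>\<^sub>\<approx>z\<in>UNIV. f z \<noteq> 0"
    using meromorphic_imp_constant_or_avoid[OF assms(1), of 0] assms(2) by auto
  hence "\<forall>\<^sub>\<approx>z\<in>UNIV. f analytic_on {z} \<and> f z \<noteq> 0"
    using meromorphic_on_imp_analytic_cosparse[OF assms(1)] by eventually_elim auto
  hence "{z. \<not> (f analytic_on {z} \<and> f z \<noteq> 0)} sparse_in UNIV"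
    by (simp add: eventually_cosparse)
  from sparse_in_union'[OF sparse_in_singleton[of 0] this] show ?thesis
    by (simp add: bad_points_def)
qed

section \<open>Removing zeros and poles on an open set\<close>

context
  fixes f :: "complex \<Rightarrow> complex"
  assumes mero: "f meromorphic_on UNIV" and sparse: "bad_points f sparse_in UNIV"
begin

lemma finite_bad_points: "finite (bad_points f \<inter> cball 0 r)"
  using sparse_in_compact_finite[of "bad_points f" "cball 0 r"] sparse
  by (metis Int_commute compact_cball sparse_in_subset top_greatest)

lemma eventually_not_bad_points: "\<forall>\<^sub>F w in at z. w \<notin> bad_points f"
proof -
  have "\<forall>\<^sub>\<approx>w\<in>UNIV. w \<notin> bad_points f"
    using sparse by (simp add: eventually_cosparse)
  thus ?thesis using eventually_cosparse_imp_eventually_at[of _ UNIV z UNIV] by fastforce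
qed

lemma eventually_nonzero: "\<forall>\<^sub>F w in at z. f w \<noteq> 0"
  using eventually_not_bad_points[of z] by eventually_elim (auto simp: bad_points_def)

lemma frequently_nonzero: "\<exists>\<^sub>F w in at z. f w \<noteq> 0"
  using eventually_nonzero by (rule eventually_frequently[rotated]) simp

lemma meromorphic_isolated: "isolated_singularity_at f z" "not_essential f z"
  using meromorphic_on_subset[OF mero, of "{z}"] by (auto simp: meromorphic_at_iff)

lemma zor_poly_nonzero: "zor_poly f z z \<noteq> 0"
  and zor_poly_analytic: "zor_poly f z analytic_on {z}"
proof -
  obtain r where r: "zor_poly f z z \<noteq> 0" "r > 0" "zor_poly f z holomorphic_on cball z r"
    using zorder_exist[OF meromorphic_isolated frequently_nonzero, of z] by blast
  thus "zor_poly f z z \<noteq> 0" by simp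
  have "zor_poly f z holomorphic_on ball z r" by (rule holomorphic_on_subset[OF r(3)]) auto
  thus "zor_poly f z analytic_on {z}" using r(2) unfolding analytic_at
    by (intro exI[of _ "ball z r"]) auto
qed

text \<open>Multiplying \<open>f\<close> by the inverse powers leaves removable singularities with
  nonzero limits at the points of \<open>Z\<close>, and \<open>remove_sings\<close> fills them in.
  Points of order 0 in \<open>Z\<close> merely contribute the factor 1.\<close>

lemma divide_out_zeros_poles:
  assumes "finite Z" "0 \<in> Z" "open S" "\<And>z. z \<in> S - Z \<Longrightarrow> z \<notin> bad_points f"
  obtains g where "g holomorphic_on S" "\<And>z. z \<in> S \<Longrightarrow> g z \<noteq> 0"
    "\<And>z. z \<in> S - Z \<Longrightarrow> f z = (\<Prod>a\<in>Z. (z - a) powi zorder f a) * g z"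
proof -
  define P where "P = (\<lambda>Y z. \<Prod>a\<in>Y. (z - a) powi (- zorder f a))"
  define g0 where "g0 = (\<lambda>z. f z * P Z z)"
  have Pan: "P Y analytic_on {z}" "P Y z \<noteq> 0" if "z \<notin> Y" "finite Y" for Y z
    unfolding P_def using that by (auto intro!: analytic_intros)
  have good: "g0 analytic_on {z} \<and> g0 z \<noteq> 0" if "z \<in> S - Z" for z
    using Pan[of z Z] assms that by (auto simp: g0_def bad_points_def intro!: analytic_intros)
  have sing: "remove_sings g0 analytic_on {z} \<and> remove_sings g0 z \<noteq> 0" if "z \<in> Z" for z
  proof -
    \<comment> \<open>Near \<open>z\<close> the power belonging to \<open>z\<close> cancels the one
      in the local expansion of \<open>f\<close>; what remains is analytic and nonzero at
      \<open>z\<close>.\<close>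
    define q where "q = (\<lambda>w. zor_poly f z w * P (Z - {z}) w)"
    have q: "q analytic_on {z}" "q z \<noteq> 0"
      using Pan[of z "Z - {z}"] assms zor_poly_nonzero[of z] zor_poly_analytic[of z]
      by (auto simp: q_def intro!: analytic_intros)
    have "\<forall>\<^sub>F w in at z. q w = g0 w"
      using zor_poly_eq[OF meromorphic_isolated frequently_nonzero, of z]
    proof eventually_elim
      case (elim w)
      have "P Z w = (w - z) powi (- zorder f z) * P (Z - {z}) w"
        unfolding P_def using assms(1) that by (subst prod.remove[of Z z]) auto
      thus ?case using elim by (simp add: q_def g0_def)
    qed
    moreover have "q \<midarrow>z\<rightarrow> q z"
      using q(1) analytic_at_imp_isCont isCont_def by blast
    ultimately have lim: "g0 \<midarrow>z\<rightarrow> q z" using tendsto_cong by blast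
    have "g0 meromorphic_on {z}"
      unfolding g0_def P_def using mero
      by (intro meromorphic_intros) (auto intro: meromorphic_on_subset)
    hence "isolated_singularity_at g0 z" by (simp add: meromorphic_at_iff)
    from remove_sings_analytic_at[OF this lim] remove_sings_eqI[OF lim] q(2)
    show ?thesis by auto
  qed
  have all: "remove_sings g0 analytic_on {z} \<and> remove_sings g0 z \<noteq> 0" if "z \<in> S" for z
    using sing[of z] good[of z] that remove_sings_analytic_on[of g0 "{z}"] by (cases "z \<in> Z") auto
  show ?thesis
  proof
    have "remove_sings g0 analytic_on S" using all analytic_on_analytic_at by blast
    thus "remove_sings g0 holomorphic_on S" by (rule analytic_imp_holomorphic)
    show "f z = (\<Prod>a\<in>Z. (z - a) powi zorder f a) * remove_sings g0 z" if "z \<in> S - Z" for z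
    proof -
      have "remove_sings g0 z = g0 z" using good[OF that] by simp
      moreover have "(\<Prod>a\<in>Z. (z - a) powi zorder f a) * P Z z = (\<Prod>a\<in>Z. 1)"
        unfolding P_def prod.distrib[symmetric] using that
        by (intro prod.cong) (auto simp: power_int_minus intro!: right_inverse)
      ultimately show ?thesis by (simp add: g0_def mult.left_commute)
    qed
  qed (use all in auto)
qed

end

text \<open>The Blaschke factor of the disc of radius \<open>r\<close>, equal to
  \<open>z / r\<close> for \<open>a = 0\<close>. Dividing the denominator by \<open>r\<close> gives
  the factor modulus 1 on the circle.\<close>

definition blaschke :: "real \<Rightarrow> complex \<Rightarrow> complex \<Rightarrow> complex" where
  "blaschke r a z = (z - a) / ((of_real (r\<^sup>2) - cnj a * z) / of_real r)"

text \<open>Staying in the right half-plane keeps the denominator off the branch cut of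
  \<open>Ln\<close>.\<close>

lemma blaschke_denom:
  assumes "norm a < r" "norm z \<le> r"
  shows "Re ((of_real (r\<^sup>2) - cnj a * z) / of_real r) > 0"
proof -
  have r: "r > 0" using assms by (smt (verit) norm_ge_zero)
  have "Re (cnj a * z) \<le> norm (cnj a * z)" by (rule complex_Re_le_cmod)
  also have "\<dots> \<le> norm a * r" using assms by (simp add: norm_mult mult_left_mono)
  also have "\<dots> < r * r" using assms r by (intro mult_strict_right_mono) auto
  finally show ?thesis using r by (simp add: power2_eq_square Re_divide_of_real)
qed

text \<open>On the circle the squared radius is \<open>z * cnj z\<close>, so numerator and
  denominator have the same modulus.\<close>

lemma norm_blaschke_circle:
  assumes "norm a < r" "norm z = r"
  shows "norm (blaschke r a z) = 1"
proof -
  have r: "r > 0" using assms by (smt (verit) norm_ge_zero)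
  have z: "z \<noteq> a" using assms by auto
  have "of_real (r\<^sup>2) - cnj a * z = z * cnj (z - a)"
    using complex_norm_square[of z] assms by (simp add: algebra_simps)
  hence "norm (of_real (r\<^sup>2) - cnj a * z) = r * norm (z - a)"
    using assms(2) by (simp add: norm_mult complex_mod_cnj del: complex_cnj_diff)
  thus ?thesis using r z by (simp add: blaschke_def norm_divide norm_mult mult.commute)
qed


lemma ln_powi: "x > 0 \<Longrightarrow> ln (x powi n) = of_int n * ln (x :: real)"
  by (simp add: ln_powr flip: powr_real_of_int')

text \<open>The weight of a point in the integrated counting function: minus the logarithm of the
  modulus of its Blaschke factor at the origin. The value at 0 matches the term
  \<open>n(0) log r\<close>.\<close>

definition log_weight :: "real \<Rightarrow> complex \<Rightarrow> real" where
  "log_weight r a = (if a = 0 then ln r else ln (r / norm a))"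

definition divisor_points :: "(complex \<Rightarrow> complex) \<Rightarrow> real \<Rightarrow> complex set" where
  "divisor_points f r = bad_points f \<inter> ball 0 r"

section \<open>Factorisation on a disc and its value at the origin\<close>

context
  fixes f :: "complex \<Rightarrow> complex"
  assumes mero: "f meromorphic_on UNIV" and sparse: "bad_points f sparse_in UNIV"
begin

lemma finite_divisor_points: "finite (divisor_points f r)"
  using finite_bad_points[OF mero sparse, of r]
  by (rule rev_finite_subset) (auto simp: divisor_points_def)

text \<open>Divide out zeros and poles on a slightly larger disc, take a holomorphic logarithm of
  the nonvanishing rest, and absorb the denominators of the Blaschke factors into it.\<close>

lemma blaschke_factorization:
  assumes "r > 0" and sphere: "bad_points f \<inter> sphere 0 r = {}"
  obtains G where "continuous_on (cball 0 r) G" "G holomorphic_on ball 0 r"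
    "\<And>z. z \<in> cball 0 r - bad_points f \<Longrightarrow>
       f z = (\<Prod>a\<in>divisor_points f r. blaschke r a z powi zorder f a) * exp (G z)"
proof -
  define Z where "Z = divisor_points f r"
  \<comment> \<open>\<open>W\<close> holds the bad points beyond the circle up to modulus
    \<open>r + 1\<close>. The radius \<open>R\<close> below stops at the nearest of them, so the
    open disc of radius \<open>R\<close> has no bad points outside \<open>Z\<close>.\<close>
  define W where "W = bad_points f \<inter> cball 0 (r + 1) - Z"
  have fin: "finite Z" "finite W"
    using finite_bad_points[OF mero sparse] finite_divisor_points by (auto simp: Z_def W_def)
  define R where "R = Min (insert (r + 1) (norm ` W))"
  have W: "norm w > r" if "w \<in> W" for w
    using that sphere by (auto simp: W_def Z_def divisor_points_def disjoint_iff not_less)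
  have R: "R > r" unfolding R_def using fin W by (subst Min_gr_iff) auto
  have RS: "z \<notin> bad_points f" if "z \<in> ball 0 R - Z" for z
  proof
    assume z: "z \<in> bad_points f"
    have "R \<le> r + 1" unfolding R_def using fin by simp
    hence "z \<in> W" using that z by (auto simp: W_def)
    hence "R \<le> norm z" unfolding R_def using fin by simp
    thus False using that by simp
  qed
  have Z: "norm a < r" if "a \<in> Z" for a using that by (auto simp: Z_def divisor_points_def)
  have 0: "0 \<in> Z" using assms(1) by (simp add: Z_def divisor_points_def bad_points_def)
  obtain g where g: "g holomorphic_on ball 0 R" "\<And>z. z \<in> ball 0 R \<Longrightarrow> g z \<noteq> 0"
    "\<And>z. z \<in> ball 0 R - Z \<Longrightarrow> f z = (\<Prod>a\<in>Z. (z - a) powi zorder f a) * g z"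
    using divide_out_zeros_poles[OF mero sparse fin(1) 0 open_ball RS] by blast
  obtain G0 where G0: "G0 holomorphic_on ball 0 R" "\<And>z. z \<in> ball 0 R \<Longrightarrow> exp (G0 z) = g z"
    using holomorphic_logarithm_exists[OF convex_ball open_ball g(1,2), of 0] R assms(1) by auto
  define D where "D = (\<lambda>a z. (of_real (r\<^sup>2) - cnj a * z) / complex_of_real r)"
  have D: "Re (D a z) > 0" if "a \<in> Z" "z \<in> cball 0 r" for a z
    unfolding D_def using that Z by (intro blaschke_denom) auto
  have Dc: "D a z \<notin> \<real>\<^sub>\<le>\<^sub>0" "D a z \<noteq> 0" if "a \<in> Z" "z \<in> cball 0 r" for a z
    using D[OF that] by (auto simp: complex_nonpos_Reals_iff)
  \<comment> \<open>Each Blaschke factor divides by \<open>D\<close>, so \<open>G\<close> must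
    restore these denominators with the same multiplicities.\<close>
  define G where "G = (\<lambda>z. G0 z + (\<Sum>a\<in>Z. of_int (zorder f a) * Ln (D a z)))"
  have sub: "cball 0 r \<subseteq> ball 0 R" "ball 0 r \<subseteq> ball 0 R" using R by auto
  show ?thesis
  proof
    have "continuous_on (cball 0 r) (D a)" for a
      unfolding D_def using assms(1) by (intro continuous_intros) auto
    moreover have "continuous_on (cball 0 r) G0"
      using G0(1) sub(1) holomorphic_on_imp_continuous_on holomorphic_on_subset by blast
    ultimately show "continuous_on (cball 0 r) G"
      unfolding G_def using Dc by (intro continuous_intros) auto
    have "D a holomorphic_on ball 0 r" for a
      unfolding D_def using assms(1) by (intro holomorphic_intros) auto
    moreover have "G0 holomorphic_on ball 0 r"
      using G0(1) sub(2) holomorphic_on_subset by blast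
    ultimately show "G holomorphic_on ball 0 r"
      unfolding G_def using Dc(1) by (intro holomorphic_intros) auto
    show "f z = (\<Prod>a\<in>divisor_points f r. blaschke r a z powi zorder f a) * exp (G z)"
      if z: "z \<in> cball 0 r - bad_points f" for z
    proof -
      have "exp (G z) = g z * (\<Prod>a\<in>Z. D a z powi zorder f a)"
        using z R G0(2)[of z] Dc(2) fin
        by (auto simp: G_def exp_add exp_sum intro!: prod.cong simp flip: exp_power_int)
      hence "(\<Prod>a\<in>Z. blaschke r a z powi zorder f a) * exp (G z)
          = (\<Prod>a\<in>Z. blaschke r a z powi zorder f a * D a z powi zorder f a) * g z"
        by (simp add: prod.distrib)
      also have "\<dots> = (\<Prod>a\<in>Z. (z - a) powi zorder f a) * g z"
      proof -
        have "blaschke r a z powi k * D a z powi k = (z - a) powi k" if "a \<in> Z" for a k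
        proof -
          have "blaschke r a z = (z - a) / D a z" by (simp add: blaschke_def D_def)
          thus ?thesis using Dc(2)[of a z] that z by (simp flip: power_int_mult_distrib)
        qed
        thus ?thesis by simp
      qed
      also have "\<dots> = f z" using z R by (subst g(3)) (auto simp: Z_def divisor_points_def)
      finally show ?thesis by (simp add: Z_def)
    qed
  qed
qed

text \<open>\<open>zor_poly f 0 0\<close> is the leading Laurent coefficient at the origin. Cancel
  the power of \<open>z\<close> in the factorisation and let \<open>z\<close> tend to 0; the other
  Blaschke factors have modulus \<open>norm a / r\<close> there.\<close>

lemma blaschke_factorization_at_0:
  assumes "r > 0" and sphere: "bad_points f \<inter> sphere 0 r = {}"
    and G: "continuous_on (cball 0 r) G"
      "\<And>z. z \<in> cball 0 r - bad_points f \<Longrightarrow>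
       f z = (\<Prod>a\<in>divisor_points f r. blaschke r a z powi zorder f a) * exp (G z)"
  shows "Re (G 0) = ln (norm (zor_poly f 0 0)) + 
    (\<Sum>a\<in>divisor_points f r. of_int (zorder f a) * log_weight r a)"
proof -
  define Z where "Z = divisor_points f r"
  have fin: "finite Z" using finite_divisor_points by (simp add: Z_def)
  have 0: "0 \<in> Z" using assms(1) by (simp add: Z_def divisor_points_def bad_points_def)
  have Z: "norm a < r" if "a \<in> Z" for a using that by (auto simp: Z_def divisor_points_def)
  define k where "k = zorder f 0"
  \<comment> \<open>The factorisation without the power of \<open>z\<close>: the factor of the
    origin is \<open>z / r\<close>, which leaves \<open>r powi (-k)\<close>.\<close>
  define q where "q = (\<lambda>z. of_real r powi (-k) * (\<Prod>a\<in>Z - {0}. blaschke r a z powi zorder f a) * exp (G z))"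
  have "\<forall>\<^sub>F w in at 0. w \<in> ball 0 r - {0}"
    using assms(1) by (intro eventually_at_in_open) auto
  moreover note zor_poly_eq[OF meromorphic_isolated[OF mero sparse] frequently_nonzero[OF mero sparse], of 0] 
    eventually_not_bad_points[OF mero sparse, of 0]
  ultimately have "\<forall>\<^sub>F w in at 0. zor_poly f 0 w = q w"
  proof eventually_elim
    case (elim w)
    have "f w = blaschke r 0 w powi k * (\<Prod>a\<in>Z - {0}. blaschke r a w powi zorder f a) * exp (G w)"
      using elim G(2)[of w] fin 0 by (simp add: prod.remove[of Z 0] flip: Z_def k_def)
    moreover have "blaschke r 0 w powi k = w powi k * of_real r powi (-k)"
      using assms(1) by (simp add: blaschke_def power2_eq_square power_int_divide_distrib power_int_minus field_simps)
    moreover have "w powi k * w powi (-k) = 1"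
      using elim by (simp add: power_int_minus)
    ultimately show ?case using elim(2) by (simp add: q_def k_def mult_ac)
  qed
  moreover have "isCont q 0"
  proof -
    have "isCont G 0" using G(1) assms(1) by (intro continuous_on_interior[OF G(1)]) auto
    moreover have "isCont (blaschke r a) 0" for a
      unfolding blaschke_def using assms(1) by (intro continuous_intros) auto
    moreover have "blaschke r a 0 \<noteq> 0" if "a \<noteq> 0" for a
      using that assms(1) by (auto simp: blaschke_def)
    ultimately show ?thesis unfolding q_def by (intro continuous_intros) auto
  qed
  moreover have "isCont (zor_poly f 0) 0"
    using zor_poly_analytic[OF mero sparse] analytic_at_imp_isCont by blast
  ultimately have "(q \<longlongrightarrow> zor_poly f 0 0) (at 0)" "(q \<longlongrightarrow> q 0) (at 0)"
    unfolding isCont_def by (auto elim: Lim_transform_eventually)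
  hence "zor_poly f 0 0 = q 0"
    by (rule tendsto_unique[rotated]) auto
  hence "norm (zor_poly f 0 0) = r powi (-k) * (\<Prod>a\<in>Z - {0}. norm (blaschke r a 0) powi zorder f a) * exp (Re (G 0))"
    using assms(1) by (simp add: q_def norm_mult norm_power_int flip: prod_norm norm_exp_eq_Re)
  moreover have "norm (blaschke r a 0) = norm a / r" for a
    using assms(1) by (simp add: blaschke_def norm_divide power2_eq_square)
  ultimately have "ln (norm (zor_poly f 0 0)) = ln (r powi (-k)) + ln (\<Prod>a\<in>Z - {0}. (norm a / r) powi zorder f a) + Re (G 0)"
    using assms(1) fin by (simp add: ln_mult prod_pos)
  also have "ln (\<Prod>a\<in>Z - {0}. (norm a / r) powi zorder f a) = (\<Sum>a\<in>Z-{0}. - (of_int (zorder f a) * log_weight r a))"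
    using fin assms(1) by (subst ln_prod) (auto simp: log_weight_def ln_div right_diff_distrib ln_powi intro!: sum.cong)
  also have "ln (r powi (-k)) = - (of_int k * log_weight r 0)"
    using assms(1) by (simp add: log_weight_def ln_powi)
  finally show ?thesis
    using fin 0 by (simp add: sum.remove[of Z 0] sum_negf k_def flip: Z_def)
qed

end

section \<open>The counting function and Jensen's formula\<close>

context
  fixes f :: "complex \<Rightarrow> complex" and r :: real
  assumes mero: "f meromorphic_on UNIV" and sparse: "bad_points f sparse_in UNIV"
    and r: "r > 0" and sphere: "bad_points f \<inter> sphere 0 r = {}"
begin

lemma pole_bad_point: "is_pole f z \<Longrightarrow> z \<in> bad_points f"
  using analytic_at_imp_no_pole by (auto simp: bad_points_def)

text \<open>One finite index set serves all \<open>t \<le> r\<close>, so the count can be integrated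
  term by term. The open disc suffices at \<open>t = r\<close> because no pole lies on the
  circle.\<close>

lemma pole_count_eq:
  assumes "t \<le> r"
  shows "real (pole_count t f) =
    (\<Sum>a\<in>divisor_points f r. real (nat (- zorder f a)) * (if norm a \<le> t then 1 else 0))"
proof -
  have fin: "finite (divisor_points f r)" by (rule finite_divisor_points[OF mero sparse])
  have "pole_count t f = (\<Sum>a\<in>{a\<in>divisor_points f r. norm a \<le> t}. nat (- zorder f a))"
    unfolding pole_count_def
  proof (rule sum.mono_neutral_left)
    show "{z. norm z \<le> t \<and> is_pole f z} \<subseteq> {a \<in> divisor_points f r. norm a \<le> t}"
    proof safe
      fix z assume z: "norm z \<le> t" "is_pole f z"
      hence "norm z \<noteq> r" using pole_bad_point[of z] sphere by auto
      thus "z \<in> divisor_points f r"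
        using z pole_bad_point[of z] assms by (auto simp: divisor_points_def)
    qed
    show "\<forall>a\<in>{a \<in> divisor_points f r. norm a \<le> t} - {z. norm z \<le> t \<and> is_pole f z}. nat (- zorder f a) = 0"
      using neg_zorder_imp_is_pole[OF meromorphic_isolated[OF mero sparse] _ frequently_nonzero[OF mero sparse]]
      by force
  qed (use fin in auto)
  also have "\<dots> = (\<Sum>a\<in>divisor_points f r. if norm a \<le> t then nat (- zorder f a) else 0)"
    using fin by (rule sum.inter_filter)
  finally show ?thesis by (simp add: if_distrib cong: if_cong)
qed

text \<open>A pole at \<open>a \<noteq> 0\<close> contributes the integral of \<open>1 / t\<close>
  from \<open>norm a\<close> to \<open>r\<close>. The origin cancels in the integrand and returns
  through the term with \<open>ln r\<close>.\<close>

lemma pole_counting_eq: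
  "pole_counting r f = (\<Sum>a\<in>divisor_points f r. real (nat (- zorder f a)) * log_weight r a)"
proof -
  define Z where "Z = divisor_points f r"
  have fin: "finite Z" using finite_divisor_points[OF mero sparse] by (simp add: Z_def)
  have 0: "0 \<in> Z" using r by (simp add: Z_def divisor_points_def bad_points_def)
  have Z: "norm a < r" if "a \<in> Z" for a using that by (auto simp: Z_def divisor_points_def)
  define m where "m = (\<lambda>a. real (nat (- zorder f a)))"
  have c0: "real (pole_count 0 f) = m 0"
    using r fin 0 by (simp add: pole_count_eq sum.remove[of Z 0] m_def flip: Z_def)
  have I: "((\<lambda>t. if norm a \<le> t then 1 / t else 0) has_integral log_weight r a) {0..r}"
    if "a \<in> Z - {0}" for a
  proof -
    have a: "0 < norm a" "norm a < r" using that Z by auto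
    have "((\<lambda>t. 1 / t) has_integral ln r - ln (norm a)) {norm a..r}"
      using a less_le_trans[OF a(1)] by (intro fundamental_theorem_of_calculus)
        (auto intro!: derivative_eq_intros simp flip: has_real_derivative_iff_has_vector_derivative)
    hence "((\<lambda>t. if t \<in> {norm a..r} then 1 / t else 0) has_integral ln r - ln (norm a)) {0..r}"
      using a by (subst has_integral_restrict) auto
    moreover have "log_weight r a = ln r - ln (norm a)"
      using a r by (simp add: log_weight_def ln_div)
    ultimately show ?thesis by (subst has_integral_cong[where g = "\<lambda>t. if t \<in> {norm a..r} then 1 / t else 0"]) auto
  qed
  have "((\<lambda>t. \<Sum>a\<in>Z-{0}. m a * (if norm a \<le> t then 1 / t else 0)) has_integral
      (\<Sum>a\<in>Z-{0}. m a * log_weight r a)) {0..r}"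
    using fin by (intro has_integral_sum has_integral_mult_right I) auto
  moreover have "(real (pole_count t f) - real (pole_count 0 f)) / t =
      (\<Sum>a\<in>Z-{0}. m a * (if norm a \<le> t then 1 / t else 0))" if "t \<in> {0..r}" for t
  proof -
    have "real (pole_count t f) = m 0 + (\<Sum>a\<in>Z-{0}. m a * (if norm a \<le> t then 1 else 0))"
      using that fin 0 by (simp add: pole_count_eq sum.remove[of Z 0] m_def flip: Z_def)
    hence "(real (pole_count t f) - real (pole_count 0 f)) / t =
        (\<Sum>a\<in>Z-{0}. m a * (if norm a \<le> t then 1 else 0) / t)"
      by (simp add: c0 sum_divide_distrib)
    also have "\<dots> = (\<Sum>a\<in>Z-{0}. m a * (if norm a \<le> t then 1 / t else 0))"
      by (intro sum.cong refl) simp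
    finally show ?thesis .
  qed
  ultimately have "integral {0..r} (\<lambda>t. (real (pole_count t f) - real (pole_count 0 f)) / t)
      = (\<Sum>a\<in>Z-{0}. m a * log_weight r a)"
    by (subst integral_cong[where g = "\<lambda>t. \<Sum>a\<in>Z-{0}. m a * (if norm a \<le> t then 1 / t else 0)"])
       (auto simp: integral_unique)
  thus ?thesis
    using fin 0 by (simp add: pole_counting_def c0 m_def log_weight_def sum.remove[of Z 0] flip: Z_def)
qed

text \<open>Poisson--Jensen: on the circle \<open>ln \<bar>f\<bar> = Re G\<close>, and \<open>\<bar>x\<bar> = 2 max 0 x - x\<close>, so that
  the first main theorem takes the form of an identity for the mean of \<open>\<bar>Re G\<bar>\<close>.\<close>

lemma poisson_jensen:
  obtains G where "continuous_on (cball 0 r) G" "G holomorphic_on ball 0 r"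
    "\<And>z. z \<in> cball 0 r - bad_points f \<Longrightarrow>
       f z = (\<Prod>a\<in>divisor_points f r. blaschke r a z powi zorder f a) * exp (G z)"
    "circle_mean r (\<lambda>z. \<bar>Re (G z)\<bar>) + (\<Sum>a\<in>divisor_points f r. \<bar>zorder f a\<bar> * log_weight r a) =
       2 * nevanlinna_char r f - ln (norm (zor_poly f 0 0))"
proof -
  obtain G where G: "continuous_on (cball 0 r) G" "G holomorphic_on ball 0 r"
    "\<And>z. z \<in> cball 0 r - bad_points f \<Longrightarrow>
       f z = (\<Prod>a\<in>divisor_points f r. blaschke r a z powi zorder f a) * exp (G z)"
    using blaschke_factorization[OF mero sparse r sphere] by blast
  have cont: "continuous_on (sphere 0 r) G" using G(1) by (rule continuous_on_subset) auto
  have lp: "log_plus (norm (f z)) = max 0 (Re (G z))" if "norm z = r" for z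
  proof -
    have "z \<in> cball 0 r - bad_points f" using that sphere by auto
    hence "norm (f z) = (\<Prod>a\<in>divisor_points f r. norm (blaschke r a z powi zorder f a)) * exp (Re (G z))"
      using G(3) by (simp add: norm_mult norm_exp_eq_Re prod_norm)
    also have "(\<Prod>a\<in>divisor_points f r. norm (blaschke r a z powi zorder f a)) = 1"
      using that by (intro prod.neutral ballI) (auto simp: norm_power_int norm_blaschke_circle divisor_points_def)
    finally show ?thesis
      by (cases "Re (G z) \<ge> 0") (auto simp: log_plus_def max_def)
  qed
  have "circle_mean r (\<lambda>z. \<bar>Re (G z)\<bar>) = circle_mean r (\<lambda>z. 2 * max 0 (Re (G z)) - Re (G z))"
    using r by (intro circle_mean_cong) auto
  also have "\<dots> = 2 * circle_mean r (\<lambda>z. max 0 (Re (G z))) - circle_mean r (\<lambda>z. Re (G z))"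
    using r cont by (subst circle_mean_diff) (auto intro!: continuous_intros simp: circle_mean_cmult)
  also have "circle_mean r (\<lambda>z. max 0 (Re (G z))) = proximity r f"
    unfolding proximity_eq_circle_mean using r lp by (intro circle_mean_cong) auto
  also have "circle_mean r (\<lambda>z. Re (G z)) = Re (G 0)"
    using G r by (intro circle_mean_Re_holomorphic)
  also have "Re (G 0) = ln (norm (zor_poly f 0 0)) +
    (\<Sum>a\<in>divisor_points f r. of_int (zorder f a) * log_weight r a)"
    by (rule blaschke_factorization_at_0[OF mero sparse r sphere G(1,3)])
  finally have "circle_mean r (\<lambda>z. \<bar>Re (G z)\<bar>) = 2 * proximity r f - ln (norm (zor_poly f 0 0)) -
    (\<Sum>a\<in>divisor_points f r. of_int (zorder f a) * log_weight r a)" by simp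
  \<comment> \<open>The identity \<open>\<bar>k\<bar> = k + 2 * nat (- k)\<close> turns the signed
    sum over zeros and poles into an unsigned one, at the cost of twice the pole counting
    function.\<close>
  moreover have "(\<Sum>a\<in>divisor_points f r. \<bar>zorder f a\<bar> * log_weight r a) =
     (\<Sum>a\<in>divisor_points f r. of_int (zorder f a) * log_weight r a + 2 * (real (nat (- zorder f a)) * log_weight r a))"
    by (intro sum.cong refl) (auto simp: abs_if algebra_simps)
  hence "(\<Sum>a\<in>divisor_points f r. \<bar>zorder f a\<bar> * log_weight r a) =
     (\<Sum>a\<in>divisor_points f r. of_int (zorder f a) * log_weight r a) + 2 * pole_counting r f"
    by (simp add: sum.distrib pole_counting_eq sum_distrib_left)
  ultimately show ?thesis using G by (intro that[of G]) (auto simp: nevanlinna_char_def)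
qed

end

section \<open>Logarithmic difference quotients\<close>

text \<open>Each of the two terms controls one sign of the difference. This form serves distances to
  zeros and poles, which may be arbitrarily small.\<close>

lemma abs_ln_diff_le:
  fixes x y d :: real
  assumes "x > 0" "y > 0" "\<bar>x - y\<bar> \<le> d"
  shows "\<bar>ln x - ln y\<bar> \<le> ln (1 + d / x) + ln (1 + d / y)"
proof -
  have *: "ln a - ln b \<le> ln (1 + d / b) \<and> ln (1 + d / b) \<ge> 0" if "a > 0" "b > 0" "\<bar>a - b\<bar> \<le> d" for a b
  proof -
    have d: "d \<ge> 0" using that by linarith
    have "ln a - ln b = ln (a / b)" using that by (simp add: ln_div)
    also have "a / b \<le> 1 + d / b" using that by (simp add: field_simps)
    hence "ln (a / b) \<le> ln (1 + d / b)" using that by (intro ln_mono) auto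
    finally show ?thesis using d that by simp
  qed
  show ?thesis using *[of x y] *[of y x] assms by linarith
qed

text \<open>The counterpart for quantities bounded away from 0, applied to the denominators of the
  Blaschke factors.\<close>

lemma abs_ln_diff_le':
  fixes x y d c :: real
  assumes "x \<ge> c" "y \<ge> c" "c > 0" "\<bar>x - y\<bar> \<le> d"
  shows "\<bar>ln x - ln y\<bar> \<le> d / c"
proof -
  have *: "ln a - ln b \<le> d / c" if "a \<ge> c" "b \<ge> c" "\<bar>a - b\<bar> \<le> d" for a b
  proof -
    have "ln a - ln b = ln (a / b)" using that assms(3) by (simp add: ln_div)
    also have "\<dots> \<le> a / b - 1" using that assms(3) by (intro ln_le_minus_one) auto
    also have "\<dots> = (a - b) / b" using that assms(3) by (simp add: diff_divide_distrib)
    also have "\<dots> \<le> d / b" using that assms(3) by (intro divide_right_mono) auto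
    also have "\<dots> \<le> d / c" using that assms(3) by (intro divide_left_mono) auto
    finally show ?thesis .
  qed
  show ?thesis using *[of x y] *[of y x] assms by linarith
qed

lemma log_weight_nonneg:
  assumes "R \<ge> 1" "a \<in> divisor_points f R"
  shows "log_weight R a \<ge> 0"
  using assms by (auto simp: log_weight_def divisor_points_def)

lemma circle_mean_Re_nonneg:
  "r \<ge> 0 \<Longrightarrow> circle_mean r (\<lambda>z. \<bar>Re (G z)\<bar>) \<ge> 0"
  by (rule circle_mean_nonneg) auto

section \<open>Counting zeros and poles, and pointwise log differences\<close>

context
  fixes f :: "complex \<Rightarrow> complex"
  assumes mero: "f meromorphic_on UNIV" and sparse: "bad_points f sparse_in UNIV"
begin

lemma divisor_count_le:
  assumes "1 \<le> r" "2 * r \<le> R" "bad_points f \<inter> sphere 0 R = {}"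
  shows "(\<Sum>a\<in>divisor_points f r. \<bar>zorder f a\<bar>) * ln 2 \<le> 2 * nevanlinna_char R f - ln (norm (zor_poly f 0 0))"
proof -
  have fin: "finite (divisor_points f R)" by (rule finite_divisor_points[OF mero sparse])
  have R: "R > 0" using assms by simp
  obtain G where G: "circle_mean R (\<lambda>z. \<bar>Re (G z)\<bar>) + (\<Sum>a\<in>divisor_points f R. \<bar>zorder f a\<bar> * log_weight R a) =
       2 * nevanlinna_char R f - ln (norm (zor_poly f 0 0))"
    using poisson_jensen[OF mero sparse R assms(3)] by blast
  have "(\<Sum>a\<in>divisor_points f r. \<bar>zorder f a\<bar> * ln 2) \<le> (\<Sum>a\<in>divisor_points f r. \<bar>zorder f a\<bar> * log_weight R a)"
  proof (intro sum_mono mult_left_mono)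
    fix a assume "a \<in> divisor_points f r"
    hence a: "norm a < r" by (auto simp: divisor_points_def)
    show "ln 2 \<le> log_weight R a"
    proof (cases "a = 0")
      case False
      hence "2 \<le> R / norm a" using a assms by (simp add: field_simps)
      thus ?thesis using False by (simp add: log_weight_def ln_mono)
    qed (use assms in \<open>auto simp: log_weight_def intro!: ln_mono\<close>)
  qed auto
  also have "\<dots> \<le> (\<Sum>a\<in>divisor_points f R. \<bar>zorder f a\<bar> * log_weight R a)"
  proof (rule sum_mono2[OF fin])
    show "divisor_points f r \<subseteq> divisor_points f R" using assms by (auto simp: divisor_points_def)
    show "0 \<le> \<bar>zorder f b\<bar> * log_weight R b" if "b \<in> divisor_points f R - divisor_points f r" for b
      using that assms by (intro mult_nonneg_nonneg log_weight_nonneg) auto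
  qed
  also have "\<dots> \<le> 2 * nevanlinna_char R f - ln (norm (zor_poly f 0 0))"
    using G circle_mean_Re_nonneg[of R G] assms(1,2) by linarith
  finally show ?thesis by (simp add: sum_distrib_right)
qed

text \<open>The factorisation splits \<open>ln \<bar>f\<bar>\<close> into distances to the divisor,
  Blaschke denominators and \<open>Re G\<close>, and each is compared at \<open>z\<close> and
  \<open>w\<close>. Staying in the half disc keeps the denominators and the derivative of
  \<open>G\<close> under control.\<close>

lemma log_diff_pointwise:
  assumes r: "r \<ge> 1" and sphere: "bad_points f \<inter> sphere 0 r = {}"
    and z: "norm z \<le> r / 2" "z \<notin> bad_points f" and w: "norm w \<le> r / 2" "w \<notin> bad_points f"
    and d: "d = norm (z - w)"
  shows "\<bar>ln (norm (f z)) - ln (norm (f w))\<bar> \<le>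
    8 * d / r * (2 * nevanlinna_char r f - ln (norm (zor_poly f 0 0))) +
    (\<Sum>a\<in>divisor_points f r. \<bar>zorder f a\<bar> * (ln (1 + d / norm (z - a)) + ln (1 + d / norm (w - a)) + 2 * d / r))"
proof -
  have r0: "r > 0" using r by simp
  have d0: "d \<ge> 0" using d by simp
  obtain G where G: "continuous_on (cball 0 r) G" "G holomorphic_on ball 0 r"
    "\<And>z. z \<in> cball 0 r - bad_points f \<Longrightarrow>
       f z = (\<Prod>a\<in>divisor_points f r. blaschke r a z powi zorder f a) * exp (G z)"
    "circle_mean r (\<lambda>z. \<bar>Re (G z)\<bar>) + (\<Sum>a\<in>divisor_points f r. \<bar>zorder f a\<bar> * log_weight r a) =
       2 * nevanlinna_char r f - ln (norm (zor_poly f 0 0))"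
    using poisson_jensen[OF mero sparse r0 sphere] by blast
  define M where "M = 2 * nevanlinna_char r f - ln (norm (zor_poly f 0 0))"
  define Z where "Z = divisor_points f r"
  have fin: "finite Z" using finite_divisor_points[OF mero sparse] by (simp add: Z_def)
  have Z: "norm a < r" "a \<in> bad_points f" if "a \<in> Z" for a using that by (auto simp: Z_def divisor_points_def)
  have M: "circle_mean r (\<lambda>z. \<bar>Re (G z)\<bar>) \<le> M"
  proof -
    have "(\<Sum>a\<in>Z. \<bar>zorder f a\<bar> * log_weight r a) \<ge> 0"
      using r by (intro sum_nonneg mult_nonneg_nonneg log_weight_nonneg) (auto simp: Z_def)
    thus ?thesis using G(4) by (simp add: M_def Z_def)
  qed
  define D where "D = (\<lambda>a z. (of_real (r\<^sup>2) - cnj a * z) / complex_of_real r)"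
  have D: "norm (D a x) \<ge> r / 2" if "a \<in> Z" "norm x \<le> r / 2" for a x
  proof -
    have "norm (cnj a * x) \<le> r * (r / 2)"
      unfolding norm_mult using that Z(1)[of a] r by (intro mult_mono) auto
    moreover have "norm (complex_of_real (r\<^sup>2)) = r * r" using r by (simp add: power2_eq_square norm_mult)
    ultimately have "norm (of_real (r\<^sup>2) - cnj a * x) \<ge> r * r / 2"
      using norm_triangle_ineq2[of "complex_of_real (r\<^sup>2)" "cnj a * x"] by simp
    thus ?thesis using r by (simp add: D_def norm_divide field_simps)
  qed
  have ln_f: "ln (norm (f x)) = (\<Sum>a\<in>Z. of_int (zorder f a) * (ln (norm (x - a)) - ln (norm (D a x)))) + Re (G x)"
    if "norm x \<le> r / 2" "x \<notin> bad_points f" for x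
  proof -
    have xa: "x - a \<noteq> 0" if "a \<in> Z" for a using that Z(2) \<open>x \<notin> bad_points f\<close> by auto
    have D0: "D a x \<noteq> 0" if "a \<in> Z" for a using D[OF that \<open>norm x \<le> r / 2\<close>] r by auto
    have b: "norm (blaschke r a x) = norm (x - a) / norm (D a x)" for a
      by (simp only: blaschke_def D_def norm_divide)
    have "norm (f x) = (\<Prod>a\<in>Z. (norm (x - a) / norm (D a x)) powi zorder f a) * exp (Re (G x))"
      using G(3)[of x] that r by (simp add: Z_def norm_mult norm_power_int b flip: prod_norm norm_exp_eq_Re)
    hence "ln (norm (f x)) = ln (\<Prod>a\<in>Z. (norm (x - a) / norm (D a x)) powi zorder f a) + Re (G x)"
      using fin xa D0 by (simp add: ln_mult prod_pos)
    also have "ln (\<Prod>a\<in>Z. (norm (x - a) / norm (D a x)) powi zorder f a) =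
        (\<Sum>a\<in>Z. of_int (zorder f a) * (ln (norm (x - a)) - ln (norm (D a x))))"
      using xa D0 fin by (subst ln_prod) (auto simp: ln_powi ln_div intro!: sum.cong)
    finally show ?thesis .
  qed
  \<comment> \<open>The Poisson--Jensen identity bounds the mean of \<open>\<bar>Re G\<bar>\<close>
    by \<open>M\<close>; this bounds the derivative of \<open>G\<close> on the convex half
    disc.\<close>
  have "norm (G z - G w) \<le> 8 / r * M * norm (z - w)"
  proof (rule field_differentiable_bound[of "cball 0 (r / 2)" G "deriv G"])
    fix x :: complex assume x: "x \<in> cball 0 (r / 2)"
    have "x \<in> ball 0 r" using x r by auto
    thus "(G has_field_derivative deriv G x) (at x within cball 0 (r / 2))"
      using holomorphic_derivI[OF G(2) open_ball] by (metis has_field_derivative_at_within)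
    have "norm (deriv G x) \<le> 8 / r * circle_mean r (\<lambda>z. \<bar>Re (G z)\<bar>)"
      using x by (intro norm_deriv_le_circle_mean[OF G(1,2) r0]) auto
    also have "\<dots> \<le> 8 / r * M" using r M by (intro mult_left_mono) auto
    finally show "norm (deriv G x) \<le> 8 / r * M" .
  qed (use z w in auto)
  hence 1: "\<bar>Re (G z) - Re (G w)\<bar> \<le> 8 * d / r * M"
    using abs_Re_le_cmod[of "G z - G w"] d by (simp add: mult_ac)
  have 2: "\<bar>of_int (zorder f a) * (ln (norm (z - a)) - ln (norm (D a z))) - of_int (zorder f a) * (ln (norm (w - a)) - ln (norm (D a w)))\<bar>
     \<le> \<bar>zorder f a\<bar> * (ln (1 + d / norm (z - a)) + ln (1 + d / norm (w - a)) + 2 * d / r)" (is "?l a \<le> ?r a")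
    if a: "a \<in> Z" for a
  proof -
    have "z - a \<noteq> 0" "w - a \<noteq> 0" using a Z z w by auto
    hence "\<bar>ln (norm (z - a)) - ln (norm (w - a))\<bar> \<le> ln (1 + d / norm (z - a)) + ln (1 + d / norm (w - a))"
      unfolding d using norm_triangle_ineq3[of "z - a" "w - a"] by (intro abs_ln_diff_le) auto
    moreover have "\<bar>ln (norm (D a z)) - ln (norm (D a w))\<bar> \<le> d / (r / 2)"
    proof (rule abs_ln_diff_le')
      have "\<bar>norm (D a z) - norm (D a w)\<bar> \<le> norm (D a z - D a w)" by (rule norm_triangle_ineq3)
      \<comment> \<open>The denominator is affine in \<open>z\<close> with slope of modulus
        \<open>norm a / r < 1\<close>, so its values differ by at most \<open>d\<close>.\<close>
      also have "D a z - D a w = cnj a / of_real r * (w - z)"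
        by (simp add: D_def algebra_simps flip: diff_divide_distrib)
      also have "norm \<dots> = norm a / r * d" using r d by (simp add: norm_mult norm_divide norm_minus_commute)
      also have "\<dots> \<le> 1 * d" using Z(1)[OF a] r d0 by (intro mult_right_mono) auto
      finally show "\<bar>norm (D a z) - norm (D a w)\<bar> \<le> d" by simp
    qed (use D a z w r in auto)
    ultimately have "\<bar>(ln (norm (z - a)) - ln (norm (D a z))) - (ln (norm (w - a)) - ln (norm (D a w)))\<bar>
       \<le> ln (1 + d / norm (z - a)) + ln (1 + d / norm (w - a)) + 2 * d / r"
      by (simp only: abs_le_iff) (simp add: mult.commute)
    from mult_left_mono[OF this, of "\<bar>zorder f a\<bar>"] show ?thesis
      by (simp add: right_diff_distrib flip: abs_mult)
  qed
  have "ln (norm (f z)) - ln (norm (f w)) =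
     (\<Sum>a\<in>Z. of_int (zorder f a) * (ln (norm (z - a)) - ln (norm (D a z))) - of_int (zorder f a) * (ln (norm (w - a)) - ln (norm (D a w))))
      + (Re (G z) - Re (G w))"
    using z w by (simp add: ln_f sum_subtractf)
  hence "\<bar>ln (norm (f z)) - ln (norm (f w))\<bar> \<le> (\<Sum>a\<in>Z. ?l a) + \<bar>Re (G z) - Re (G w)\<bar>"
    using sum_abs[of "\<lambda>a. of_int (zorder f a) * (ln (norm (z - a)) - ln (norm (D a z))) - of_int (zorder f a) * (ln (norm (w - a)) - ln (norm (D a w)))" Z]
    by linarith
  also have "\<dots> \<le> (\<Sum>a\<in>Z. ?r a) + 8 * d / r * M"
    using 1 2 by (intro add_mono sum_mono) auto
  finally show ?thesis by (simp add: M_def Z_def add.commute)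
qed

end

section \<open>Circular means of logarithmic difference quotients\<close>

context
  fixes f :: "complex \<Rightarrow> complex"
  assumes mero: "f meromorphic_on UNIV" and sparse: "bad_points f sparse_in UNIV"
begin

lemma continuous_on_ln_norm_shift:
  assumes "\<And>z. z \<in> S \<Longrightarrow> z + u \<notin> bad_points f"
  shows "continuous_on S (\<lambda>z. ln (norm (f (z + u))))"
proof -
  have f: "f analytic_on {z + u}" "f (z + u) \<noteq> 0" if "z \<in> S" for z
    using assms[OF that] by (auto simp: bad_points_def)
  have "isCont (\<lambda>z. f (z + u)) z" if "z \<in> S" for z
    using analytic_at_imp_isCont[OF f(1)[OF that]]
    by (intro isCont_o2[where g = f and f = "\<lambda>z. z + u"]) auto
  hence "continuous_on S (\<lambda>z. f (z + u))"
    by (simp add: continuous_at_imp_continuous_on)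
  thus ?thesis using f(2) by (intro continuous_intros) auto
qed

text \<open>The pointwise bound on the disc of radius \<open>R1\<close> is averaged over the circle;
  the kernel means are uniform in the zeros and poles, whose number is bounded through the larger
  radius \<open>R2\<close>.\<close>

lemma circle_mean_log_diff_le:
  assumes r: "r > 0" and \<alpha>: "0 < \<alpha>" "\<alpha> < 1"
    and R1: "1 \<le> R1" "bad_points f \<inter> sphere 0 R1 = {}" "r + norm u \<le> R1 / 2" "r + norm v \<le> R1 / 2"
    and R2: "2 * R1 \<le> R2" "bad_points f \<inter> sphere 0 R2 = {}"
    and good: "\<And>z. norm z = r \<Longrightarrow> z + u \<notin> bad_points f" "\<And>z. norm z = r \<Longrightarrow> z + v \<notin> bad_points f"
    and d: "d = norm (u - v)"
    and K: "2 * nevanlinna_char R1 f - ln (norm (zor_poly f 0 0)) \<le> K" 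
      "2 * nevanlinna_char R2 f - ln (norm (zor_poly f 0 0)) \<le> K"
  shows "circle_mean r (\<lambda>z. \<bar>ln (norm (f (z + u))) - ln (norm (f (z + v)))\<bar>) \<le>
     K * (8 * d / R1) + K / ln 2 * (2 * log_mean_const \<alpha> * (pi * d / r) powr \<alpha> + 2 * d / R1)"
proof -
  define Z where "Z = divisor_points f R1"
  have fin: "finite Z" using finite_divisor_points[OF mero sparse] by (simp add: Z_def)
  have d0: "d \<ge> 0" using d by simp
  have Z: "norm (a - x) \<noteq> r" if "a \<in> Z" "x = u \<or> x = v" for a x
    using good[of "a - x"] that by (auto simp: Z_def divisor_points_def)
  define L where "L = (\<lambda>b z::complex. ln (1 + d / norm (z - b)))"
  have Lc: "continuous_on (sphere 0 r) (L (a - x))" if "a \<in> Z" "x = u \<or> x = v" for a x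
    unfolding L_def using Z[OF that] d0 by (intro continuous_on_log_quotient) auto
  define c where "c = log_mean_const \<alpha> * (pi * d / r) powr \<alpha>"
  have Lm: "circle_mean r (L (a - x)) \<le> c" if "a \<in> Z" "x = u \<or> x = v" for a x
    unfolding L_def c_def using Z[OF that] d0 \<alpha> r by (intro circle_mean_log_le) auto
  define T where "T = (\<lambda>a z. \<bar>zorder f a\<bar> * (L (a - u) z + L (a - v) z + 2 * d / R1))"
  have Tc: "continuous_on (sphere 0 r) (T a)" if "a \<in> Z" for a
    unfolding T_def using that by (intro continuous_intros Lc) auto
  have Tm: "circle_mean r (T a) \<le> \<bar>zorder f a\<bar> * (c + c + 2 * d / R1)" if "a \<in> Z" for a
  proof -
    have "circle_mean r (T a) = \<bar>zorder f a\<bar> * (circle_mean r (L (a - u)) + circle_mean r (L (a - v)) + 2 * d / R1)"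
      unfolding T_def circle_mean_cmult using that r
      by (simp add: circle_mean_add continuous_on_add continuous_on_const Lc)
    also have "\<dots> \<le> \<bar>zorder f a\<bar> * (c + c + 2 * d / R1)"
      using Lm that by (intro mult_left_mono add_mono) auto
    finally show ?thesis .
  qed
  have "circle_mean r (\<lambda>z. \<bar>ln (norm (f (z + u))) - ln (norm (f (z + v)))\<bar>) \<le>
     circle_mean r (\<lambda>z. 8 * d / R1 * K + (\<Sum>a\<in>Z. T a z))"
  proof (rule circle_mean_mono)
    show "continuous_on (sphere 0 r) (\<lambda>z. \<bar>ln (norm (f (z + u))) - ln (norm (f (z + v)))\<bar>)"
      using good by (intro continuous_intros continuous_on_ln_norm_shift) auto
    show "continuous_on (sphere 0 r) (\<lambda>z. 8 * d / R1 * K + (\<Sum>a\<in>Z. T a z))"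
      using Tc by (intro continuous_intros) auto
    fix z :: complex assume z: "norm z = r"
    have "\<bar>ln (norm (f (z + u))) - ln (norm (f (z + v)))\<bar> \<le>
      8 * d / R1 * (2 * nevanlinna_char R1 f - ln (norm (zor_poly f 0 0))) +
      (\<Sum>a\<in>divisor_points f R1. \<bar>zorder f a\<bar> * (ln (1 + d / norm (z + u - a)) + ln (1 + d / norm (z + v - a)) + 2 * d / R1))"
      using R1 z good[OF z] norm_triangle_ineq[of z u] norm_triangle_ineq[of z v] d
      by (intro log_diff_pointwise[OF mero sparse]) auto
    also have "\<dots> \<le> 8 * d / R1 * K + (\<Sum>a\<in>Z. T a z)"
      using K R1 d0 by (intro add_mono mult_left_mono)
        (auto simp: Z_def T_def L_def algebra_simps intro!: sum_mono)
    finally show "\<bar>ln (norm (f (z + u))) - ln (norm (f (z + v)))\<bar> \<le> 8 * d / R1 * K + (\<Sum>a\<in>Z. T a z)" .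
  qed (use r in auto)
  also have "\<dots> = 8 * d / R1 * K + (\<Sum>a\<in>Z. circle_mean r (T a))"
    using Tc r fin by (simp add: circle_mean_add continuous_on_const continuous_on_sum circle_mean_sum)
  also have "(\<Sum>a\<in>Z. circle_mean r (T a)) \<le> (\<Sum>a\<in>Z. \<bar>zorder f a\<bar> * (c + c + 2 * d / R1))"
    by (intro sum_mono Tm)
  also have "\<dots> = (\<Sum>a\<in>Z. \<bar>zorder f a\<bar>) * (c + c + 2 * d / R1)"
    by (simp add: sum_distrib_right)
  also have "\<dots> \<le> K / ln 2 * (c + c + 2 * d / R1)"
  proof (rule mult_right_mono)
    have "(\<Sum>a\<in>Z. \<bar>zorder f a\<bar>) * ln 2 \<le> K"
      using divisor_count_le[OF mero sparse R1(1) R2] K(2) by (simp add: Z_def)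
    thus "(\<Sum>a\<in>Z. \<bar>zorder f a\<bar>) \<le> K / ln 2" by (simp add: field_simps)
    show "0 \<le> c + c + 2 * d / R1"
      using \<alpha> d0 R1 log_mean_const_nonneg[OF \<alpha>] by (auto simp: c_def)
  qed
  finally show ?thesis by (simp add: c_def algebra_simps)
qed

lemma generic_radius:
  assumes "0 < a" "a < b"
  obtains r where "a < r" "r < b" "bad_points f \<inter> sphere 0 r = {}"
proof -
  have "countable (bad_points f)"
    using sparse_imp_countable[OF open_UNIV sparse] by simp
  hence "countable (norm ` bad_points f)" by simp
  from real_interval_avoid_countable_set[OF assms(2) this]
  obtain r where "r \<in> {a<..<b}" "r \<notin> norm ` bad_points f" by blast
  thus ?thesis by (intro that[of r]) (auto simp: image_iff)
qed

text \<open>Choosing \<open>R1\<close> and \<open>R2\<close> comparable to \<open>r\<close> makes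
  the characteristic and the number of zeros and poles \<open>O(r powr s)\<close>, while every
  kernel mean gains \<open>r powr (- \<alpha>)\<close>.\<close>

lemma circle_mean_log_diff_bigo:
  assumes T: "\<forall>\<^sub>F r in at_top. nevanlinna_char r f \<le> r powr s" and s: "s \<ge> 0"
    and \<alpha>: "0 < \<alpha>" "\<alpha> < 1"
  shows "\<exists>C. \<forall>\<^sub>F r in at_top.
    (\<forall>z. norm z = r \<longrightarrow> z + u \<notin> bad_points f \<and> z + v \<notin> bad_points f) \<longrightarrow>
    circle_mean r (\<lambda>z. \<bar>ln (norm (f (z + u))) - ln (norm (f (z + v)))\<bar>) \<le> C * r powr (s - \<alpha>)"
proof -
  define d where "d = norm (u - v)"
  define l0 where "l0 = \<bar>ln (norm (zor_poly f 0 0))\<bar>"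
  \<comment> \<open>Both auxiliary radii stay below \<open>11 * r\<close>; \<open>l0\<close> absorbs
    the leading coefficient.\<close>
  define C0 where "C0 = 2 * 11 powr s + l0"
  define C where "C = C0 * (2 * d) + C0 / ln 2 * (2 * log_mean_const \<alpha> * (pi * d) powr \<alpha> + d)"
  have C0: "C0 \<ge> 0" by (simp add: C0_def l0_def)
  have d0: "d \<ge> 0" by (simp add: d_def)
  obtain r0 where r0: "\<And>r. r \<ge> r0 \<Longrightarrow> nevanlinna_char r f \<le> r powr s"
    using T by (auto simp: eventually_at_top_linorder)
  have "circle_mean r (\<lambda>z. \<bar>ln (norm (f (z + u))) - ln (norm (f (z + v)))\<bar>) \<le> C * r powr (s - \<alpha>)"
    if r: "r \<ge> r0" "r \<ge> 1" "r \<ge> norm u" "r \<ge> norm v" 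
      and good: "\<forall>z. norm z = r \<longrightarrow> z + u \<notin> bad_points f \<and> z + v \<notin> bad_points f" for r
  proof -
    \<comment> \<open>Once \<open>r\<close> exceeds \<open>norm u\<close> and \<open>norm v\<close>,
      the shifted circles lie within radius \<open>2 * r < R1 / 2\<close>. The next choice gives
      \<open>R2 > 10 * r > 2 * R1\<close>.\<close>
    obtain R1 where R1: "4 * r < R1" "R1 < 5 * r" "bad_points f \<inter> sphere 0 R1 = {}"
      using generic_radius[of "4 * r" "5 * r"] r by auto
    obtain R2 where R2: "10 * r < R2" "R2 < 11 * r" "bad_points f \<inter> sphere 0 R2 = {}"
      using generic_radius[of "10 * r" "11 * r"] r by auto
    define K where "K = C0 * r powr s"
    have K0: "K \<ge> 0" using C0 by (simp add: K_def)
    have K: "2 * nevanlinna_char R f - ln (norm (zor_poly f 0 0)) \<le> K" if "r \<le> R" "R \<le> 11 * r" for R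
    proof -
      have "nevanlinna_char R f \<le> R powr s" using that r by (intro r0) auto
      also have "\<dots> \<le> (11 * r) powr s" using that r s by (intro powr_mono2) auto
      also have "\<dots> = 11 powr s * r powr s" using r by (simp add: powr_mult)
      finally have "2 * nevanlinna_char R f \<le> 2 * 11 powr s * r powr s" by simp
      moreover have "- ln (norm (zor_poly f 0 0)) \<le> l0 * r powr s"
      proof -
        have "- ln (norm (zor_poly f 0 0)) \<le> l0 * 1" by (simp add: l0_def)
        also have "\<dots> \<le> l0 * r powr s" using r s
          by (intro mult_left_mono ge_one_powr_ge_zero) (auto simp: l0_def)
        finally show ?thesis .
      qed
      ultimately show ?thesis by (simp add: K_def C0_def algebra_simps)
    qed
    define c where "c = 2 * log_mean_const \<alpha> * (pi * d) powr \<alpha>"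
    have c0: "c \<ge> 0" using log_mean_const_nonneg[OF \<alpha>] by (simp add: c_def)
    have "circle_mean r (\<lambda>z. \<bar>ln (norm (f (z + u))) - ln (norm (f (z + v)))\<bar>) \<le>
       K * (8 * d / R1) + K / ln 2 * (2 * log_mean_const \<alpha> * (pi * d / r) powr \<alpha> + 2 * d / R1)"
      using R1 R2 r good \<alpha> K by (intro circle_mean_log_diff_le[where ?R2.0 = R2]) (auto simp: d_def)
    also have "\<dots> \<le> K * (2 * d * r powr (-\<alpha>)) + K / ln 2 * (c * r powr (-\<alpha>) + d * r powr (-\<alpha>))"
    proof -
      have "1 / R1 \<le> 1 / (4 * r)" using R1 r by (intro divide_left_mono) auto
      also have "1 / (4 * r) = r powr (-1) / 4" using r by (simp add: powr_minus_divide)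
      also have "r powr (-1) \<le> r powr (-\<alpha>)" using r \<alpha> by (intro powr_mono) auto
      finally have R: "1 / R1 \<le> r powr (-\<alpha>) / 4" by simp
      have "8 * d * (1 / R1) \<le> 8 * d * (r powr (-\<alpha>) / 4)" "2 * d * (1 / R1) \<le> 2 * d * (r powr (-\<alpha>) / 4)"
        using R d0 by (intro mult_left_mono; simp)+
      moreover have "d * r powr (-\<alpha>) \<ge> 0" using d0 by simp
      ultimately have "8 * d / R1 \<le> 2 * d * r powr (-\<alpha>)" "2 * d / R1 \<le> d * r powr (-\<alpha>)"
        by simp_all
      moreover have "2 * log_mean_const \<alpha> * (pi * d / r) powr \<alpha> = c * r powr (-\<alpha>)"
        using r d0 by (simp add: c_def powr_divide powr_minus_divide)
      ultimately show ?thesis using K0 by (intro add_mono mult_left_mono) auto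
    qed
    also have "\<dots> = C * (r powr s * r powr (-\<alpha>))"
      by (simp add: C_def K_def c_def field_simps)
    also have "r powr s * r powr (-\<alpha>) = r powr (s - \<alpha>)" by (simp flip: powr_add)
    finally show ?thesis .
  qed
  thus ?thesis
    unfolding eventually_at_top_linorder
    by (intro exI[of _ C] exI[of _ "Max {r0, 1, norm u, norm v}"]) auto
qed

end

section \<open>Orders of growth\<close>

lemma log_plus_nonneg: "log_plus x \<ge> 0"
  by (simp add: log_plus_def)

lemma exp_log_plus_ge: "x \<le> exp (log_plus x)"
  by (simp add: log_plus_def)

lemma continuous_log_plus [continuous_intros]:
  "continuous_on S g \<Longrightarrow> continuous_on S (\<lambda>x. log_plus (g x))"
  unfolding log_plus_def by (intro continuous_intros) auto

lemma growth_order_nonneg: "growth_order g \<ge> 0"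
  unfolding growth_order_def
proof (rule le_Limsup)
  show "\<forall>\<^sub>F r::real in at_top. 0 \<le> ereal (log_plus (nevanlinna_char r g) / ln r)"
    using eventually_ge_at_top[of 1] by eventually_elim (simp add: log_plus_nonneg)
qed simp

lemma growth_order_less_imp_char_le:
  assumes "growth_order g < ereal b"
  shows "\<forall>\<^sub>F r in at_top. nevanlinna_char r g \<le> r powr b"
proof -
  have "\<forall>\<^sub>F r::real in at_top. ereal (log_plus (nevanlinna_char r g) / ln r) < ereal b"
    using assms unfolding growth_order_def by (rule Limsup_lessD)
  thus ?thesis using eventually_gt_at_top[of 1]
  proof eventually_elim
    case (elim r)
    hence "log_plus (nevanlinna_char r g) < b * ln r" by (simp add: field_simps)
    hence "exp (log_plus (nevanlinna_char r g)) \<le> exp (b * ln r)" by simp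
    also have "exp (b * ln r) = r powr b" using elim(2) by (simp add: powr_def)
    finally show ?case using exp_log_plus_ge[of "nevanlinna_char r g"] by linarith
  qed
qed

lemma growth_order_greater_imp_char_gt:
  assumes "ereal b < growth_order g" "b \<ge> 0"
  shows "\<exists>\<^sub>F r in at_top. r powr b < nevanlinna_char r g"
proof (rule ccontr)
  assume "\<not> ?thesis"
  hence "\<forall>\<^sub>F r in at_top. nevanlinna_char r g \<le> r powr b"
    by (simp add: not_frequently not_less)
  hence "\<forall>\<^sub>F r::real in at_top. ereal (log_plus (nevanlinna_char r g) / ln r) \<le> ereal b"
    using eventually_gt_at_top[of 1]
  proof eventually_elim
    case (elim r)
    \<comment> \<open>Since \<open>b \<ge> 0\<close>, also \<open>1 \<le> r powr b\<close>, so the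
      truncation inside \<open>log_plus\<close> respects the bound.\<close>
    have "log_plus (nevanlinna_char r g) \<le> ln (r powr b)"
      unfolding log_plus_def using elim assms(2) by (intro ln_mono) (auto simp: ge_one_powr_ge_zero)
    thus ?case using elim by (simp add: ln_powr field_simps)
  qed
  hence "growth_order g \<le> ereal b" unfolding growth_order_def by (rule Limsup_bounded)
  thus False using assms(1) by simp
qed

lemma nevanlinna_char_entire:
  assumes "g holomorphic_on UNIV"
  shows "nevanlinna_char r g = circle_mean r (\<lambda>z. log_plus (norm (g z)))"
proof -
  have "\<not> is_pole g z" for z
    using assms by (metis UNIV_I not_is_pole_holomorphic open_UNIV)
  thus ?thesis
    by (simp add: nevanlinna_char_def pole_counting_def pole_count_def proximity_eq_circle_mean)
qed

lemma continuous_circle_mean: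
  assumes "continuous_on UNIV u"
  shows "continuous_on UNIV (\<lambda>r. circle_mean r u)"
proof -
  have "continuous_on (UNIV \<times> cbox 0 (2 * pi)) (\<lambda>(r, t). u (complex_of_real r * cis t))"
    unfolding case_prod_beta
    by (rule continuous_on_compose2[OF assms]) (auto intro!: continuous_intros)
  from integral_continuous_on_param[OF this]
  show ?thesis unfolding circle_mean_def by (intro continuous_intros) auto
qed

text \<open>The characteristic of an entire function is continuous, so a strict lower bound
  persists on an open set of radii and hence holds at radii avoiding any given countable set.\<close>

lemma frequently_char_gt_avoiding:
  assumes "g holomorphic_on UNIV" "ereal b < growth_order g" "b \<ge> 0" "countable E"
  shows "\<exists>\<^sub>F r in at_top. r powr b < nevanlinna_char r g \<and> r \<notin> E"
  unfolding frequently_def eventually_at_top_linorder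
proof safe
  fix N assume N: "\<forall>r\<ge>N. \<not> (r powr b < nevanlinna_char r g \<and> r \<notin> E)"
  define h where "h = (\<lambda>r. nevanlinna_char r g - r powr b)"
  have "continuous_on UNIV (\<lambda>r. nevanlinna_char r g)"
    unfolding nevanlinna_char_entire[OF assms(1)]
    by (intro continuous_circle_mean continuous_intros holomorphic_on_imp_continuous_on assms)
  hence cont: "continuous_on {0<..} h"
    unfolding h_def by (intro continuous_intros) (auto intro: continuous_on_subset)
  have "\<exists>\<^sub>F r in at_top. r powr b < nevanlinna_char r g \<and> r > max N 0"
    using growth_order_greater_imp_char_gt[OF assms(2,3)] eventually_gt_at_top[of "max N 0"]
    by (rule frequently_eventually_frequently)
  then obtain r where r: "r > max N 0" "0 < h r"
    unfolding h_def by (auto dest!: frequently_ex)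
  have "isCont h r" using r(1) by (intro continuous_on_interior[OF cont]) (auto simp: interior_open)
  hence "\<forall>\<^sub>F x in at r. 0 < h x"
    using r(2) unfolding isCont_def by (rule order_tendstoD)
  then obtain d where d: "d > 0" "\<And>x. x \<noteq> r \<Longrightarrow> dist x r < d \<Longrightarrow> 0 < h x"
    unfolding eventually_at by auto
  obtain x where "x \<in> {r<..<r + d}" "x \<notin> E"
    using real_interval_avoid_countable_set[of r "r + d" E] d(1) assms(4) by auto
  thus False using d(2)[of x] N r(1) by (auto simp: dist_real_def h_def)
qed

text \<open>Every summand is at most the exponential of the total \<open>E\<close>, and there are at
  most \<open>n\<close> of them. Here \<open>g\<close> will be the other coefficients and
  \<open>h\<close> quotients of shifts of \<open>f\<close>.\<close>

lemma log_plus_sum_le: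
  fixes g h :: "'a \<Rightarrow> complex"
  assumes "finite I" "card I \<le> n" "n \<ge> 1" "x = (\<Sum>i\<in>I. g i * h i)" "\<And>i. i \<in> I \<Longrightarrow> h i \<noteq> 0"
  shows "log_plus (norm x) \<le> ln n + (\<Sum>i\<in>I. log_plus (norm (g i)) + \<bar>ln (norm (h i))\<bar>)"
proof -
  define E where "E = (\<Sum>i\<in>I. log_plus (norm (g i)) + \<bar>ln (norm (h i))\<bar>)"
  have E0: "E \<ge> 0" unfolding E_def by (intro sum_nonneg add_nonneg_nonneg log_plus_nonneg) auto
  have "norm x \<le> (\<Sum>i\<in>I. norm (g i * h i))" unfolding assms(4) by (rule norm_sum)
  also have "\<dots> \<le> (\<Sum>i\<in>I. exp E)"
  proof (rule sum_mono)
    fix i assume i: "i \<in> I"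
    have "norm (h i) = exp (ln (norm (h i)))" using assms(5)[OF i] by simp
    also have "\<dots> \<le> exp \<bar>ln (norm (h i))\<bar>" by simp
    finally have "norm (g i * h i) \<le> exp (log_plus (norm (g i)) + \<bar>ln (norm (h i))\<bar>)"
      unfolding norm_mult exp_add by (intro mult_mono exp_log_plus_ge) auto
    also have "\<dots> \<le> exp E" unfolding E_def exp_le_cancel_iff
      using assms(1) i by (intro member_le_sum[where f = "\<lambda>i. log_plus (norm (g i)) + \<bar>ln (norm (h i))\<bar>"])
        (auto intro: add_nonneg_nonneg log_plus_nonneg)
    finally show "norm (g i * h i) \<le> exp E" .
  qed
  also have "\<dots> \<le> n * exp E" using assms(2) by (simp add: mult_right_mono)
  finally have "max 1 (norm x) \<le> n * exp E"
    using assms(3) E0 mult_mono[of 1 n 1 "exp E"] by simp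
  hence "log_plus (norm x) \<le> ln (n * exp E)" unfolding log_plus_def by (intro ln_mono) auto
  also have "\<dots> = ln n + E" using assms(3) by (simp add: ln_mult)
  finally show ?thesis by (simp add: E_def)
qed

text \<open>After division by \<open>r powr b\<close> every term on the left tends to 0.\<close>

lemma eventually_sum_powr_less:
  fixes c C b b' e :: real
  assumes "b > 0" "b' < b" "e < b"
  shows "\<forall>\<^sub>F r in at_top. c + k * r powr b' + C * r powr e < r powr b"
proof -
  have "((\<lambda>r::real. c * r powr (-b) + k * r powr (b' - b) + C * r powr (e - b)) \<longlongrightarrow> c * 0 + k * 0 + C * 0) at_top"
    using assms by (intro tendsto_add tendsto_mult tendsto_const tendsto_neg_powr filterlim_ident) auto
  hence "\<forall>\<^sub>F r::real in at_top. c * r powr (-b) + k * r powr (b' - b) + C * r powr (e - b) < 1"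
    by (rule order_tendstoD) auto
  thus ?thesis using eventually_gt_at_top[of 0]
  proof eventually_elim
    case (elim r)
    have "(c * r powr (-b) + k * r powr (b' - b) + C * r powr (e - b)) * r powr b < 1 * r powr b"
      using elim by (intro mult_strict_right_mono) auto
    moreover have "r powr (-b) * r powr b = 1" "r powr (b' - b) * r powr b = r powr b'" "r powr (e - b) * r powr b = r powr e"
      using elim by (simp_all flip: powr_add)
    ultimately show ?case by (simp add: distrib_right mult.assoc)
  qed
qed

section \<open>The contradiction drawn from the difference equation\<close>

theorem theorem9p2:
  fixes n l :: nat
    and A :: "nat \<Rightarrow> complex \<Rightarrow> complex"
    and f :: "complex \<Rightarrow> complex"
  assumes "n \<ge> 1"
    and "\<And>j. j \<le> n \<Longrightarrow> A j holomorphic_on UNIV"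
    and "l \<le> n"
    and "growth_order (A l) > Max {growth_order (A j) | j. j \<le> n \<and> j \<noteq> l}"
    and "f meromorphic_on UNIV"
    and "\<not> (\<forall>\<^sub>\<approx>z\<in>UNIV. f z = 0)"
    and "\<forall>\<^sub>\<approx>z\<in>UNIV. (\<Sum>j\<le>n. A j z * f (z + of_nat j)) = 0"
  shows "growth_order f \<ge> growth_order (A l) + 1"
proof (rule ccontr)
  assume "\<not> ?thesis"
  hence less: "growth_order f < growth_order (A l) + 1" by simp
  note sparse = sparse_bad_points[OF assms(5,6)]
  define J where "J = {..n} - {l}"
  define m where "m = Max (insert 0 ((\<lambda>j. growth_order (A j)) ` J))"
  have J: "finite J" "card J = n" using assms(3) by (auto simp: J_def)
  have "J \<noteq> {}" using J assms(1) by auto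
  have "{growth_order (A j) | j. j \<le> n \<and> j \<noteq> l} = (\<lambda>j. growth_order (A j)) ` J"
    by (auto simp: J_def)
  hence Max_less: "Max ((\<lambda>j. growth_order (A j)) ` J) < growth_order (A l)"
    using assms(4) by simp
  have lt: "growth_order (A j) < growth_order (A l)" if "j \<in> J" for j
    by (rule le_less_trans[OF Max_ge Max_less]) (use J(1) that in auto)
  obtain j0 where "j0 \<in> J" using \<open>J \<noteq> {}\<close> by blast
  hence "m < growth_order (A l)"
    using lt J(1) growth_order_nonneg[of "A j0"] unfolding m_def by (subst Max_less_iff) (auto intro: le_less_trans)
  moreover have "m \<ge> 0" unfolding m_def using J(1) by (intro Max_ge) auto
  moreover have mj: "growth_order (A j) \<le> m" if "j \<in> J" for j
    unfolding m_def using J(1) that by (intro Max_ge) auto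
  \<comment> \<open>\<open>m\<close> is nonnegative and strictly below another extended real, hence
    finite.\<close>
  ultimately obtain \<mu> where \<mu>: "m = ereal \<mu>" "\<mu> \<ge> 0" "ereal \<mu> < growth_order (A l)"
    by (cases m) auto
  obtain \<phi> where \<phi>: "growth_order f = ereal \<phi>" "\<phi> \<ge> 0"
    using less growth_order_nonneg[of f] by (cases "growth_order f") auto
  have "ereal (\<phi> - 1) < growth_order (A l)"
    using \<phi> less by (cases "growth_order (A l)") auto
  hence "ereal (max \<mu> (\<phi> - 1)) < growth_order (A l)"
    using \<mu>(3) by (simp add: max_def)
  \<comment> \<open>A real exponent strictly below the order of \<open>A l\<close> also covers the
    case where that order is infinite.\<close>
  then obtain b where b: "max \<mu> (\<phi> - 1) < b" "ereal b < growth_order (A l)"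
    using ereal_dense2[of "ereal (max \<mu> (\<phi> - 1))"] by (auto simp del: ereal_max)
  \<comment> \<open>Midpoints that leave room everywhere: \<open>\<mu> < b' < b\<close>,
    \<open>\<phi> < s < b + 1\<close>, and \<open>\<alpha>\<close> between
    \<open>max 0 (s - b)\<close> and 1, so that \<open>s - \<alpha> < b\<close>.\<close>
  define b' where "b' = (\<mu> + b) / 2"
  define s where "s = (\<phi> + b + 1) / 2"
  define \<alpha> where "\<alpha> = (1 + max 0 (s - b)) / 2"
  have b': "\<mu> < b'" "b' < b" "b > 0" using b \<mu> by (auto simp: b'_def)
  have s: "\<phi> < s" "s - b < 1" "s \<ge> 0" using b \<phi> b' by (auto simp: s_def field_simps)
  have \<alpha>: "0 < \<alpha>" "\<alpha> < 1" "s - \<alpha> < b" using s by (auto simp: \<alpha>_def max_def field_simps)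

  define good where "good = (\<lambda>r::real. \<forall>z. norm z = r \<longrightarrow>
    (\<forall>j\<le>n. z + of_nat j \<notin> bad_points f) \<and> (\<Sum>j\<le>n. A j z * f (z + of_nat j)) = 0)"
  \<comment> \<open>The radii of circles that meet a shifted bad point or a point where the equation
    fails. Sparse sets are countable, hence so is \<open>E\<close>.\<close>
  define E where "E = norm ` ((\<Union>j\<le>n. (\<lambda>w. w - of_nat j) ` bad_points f) \<union> {z. (\<Sum>j\<le>n. A j z * f (z + of_nat j)) \<noteq> 0})"
  have "countable E"
    using sparse_imp_countable[OF open_UNIV sparse] assms(7)
      sparse_imp_countable[OF open_UNIV, of "{z. (\<Sum>j\<le>n. A j z * f (z + of_nat j)) \<noteq> 0}"]
    unfolding E_def by (intro countable_image countable_Un countable_UN) (auto simp: eventually_cosparse)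
  have good: "good r" if "r \<notin> E" for r
    unfolding good_def
  proof safe
    fix z :: complex and j assume z: "r = norm z" "j \<le> n" "z + of_nat j \<in> bad_points f"
    hence "z \<in> (\<Union>j\<le>n. (\<lambda>w. w - of_nat j) ` bad_points f)"
      by (intro UN_I[of j] image_eqI[of _ _ "z + of_nat j"]) auto
    thus False using that z(1) by (auto simp: E_def)
  qed (use that in \<open>auto simp: E_def\<close>)

  define q where "q = (\<lambda>j r. circle_mean r (\<lambda>z. \<bar>ln (norm (f (z + of_nat j))) - ln (norm (f (z + of_nat l)))\<bar>))"
  have "\<forall>j. \<exists>C. j \<in> J \<longrightarrow> (\<forall>\<^sub>F r in at_top. good r \<longrightarrow> q j r \<le> C * r powr (s - \<alpha>))"
  proof
    fix j
    have "\<forall>\<^sub>F r in at_top. nevanlinna_char r f \<le> r powr s"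
      using s \<phi> by (intro growth_order_less_imp_char_le) auto
    from circle_mean_log_diff_bigo[OF assms(5) sparse this s(3) \<alpha>(1,2), of "of_nat j" "of_nat l"]
    obtain C where C: "\<forall>\<^sub>F r in at_top.
      (\<forall>z. norm z = r \<longrightarrow> z + of_nat j \<notin> bad_points f \<and> z + of_nat l \<notin> bad_points f) \<longrightarrow>
      q j r \<le> C * r powr (s - \<alpha>)" unfolding q_def by blast
    show "\<exists>C. j \<in> J \<longrightarrow> (\<forall>\<^sub>F r in at_top. good r \<longrightarrow> q j r \<le> C * r powr (s - \<alpha>))"
    proof (intro exI impI)
      assume "j \<in> J"
      show "\<forall>\<^sub>F r in at_top. good r \<longrightarrow> q j r \<le> C * r powr (s - \<alpha>)"
        using C by eventually_elim (use \<open>j \<in> J\<close> assms(3) in \<open>auto simp: good_def J_def\<close>)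
    qed
  qed
  then obtain C where C: "\<And>j. j \<in> J \<Longrightarrow> \<forall>\<^sub>F r in at_top. good r \<longrightarrow> q j r \<le> C j * r powr (s - \<alpha>)"
    by metis
  have "\<forall>\<^sub>F r in at_top. \<forall>j\<in>J. good r \<longrightarrow> q j r \<le> C j * r powr (s - \<alpha>)"
    using J(1) C by (intro eventually_ball_finite) auto
  moreover have "\<forall>\<^sub>F r in at_top. \<forall>j\<in>J. nevanlinna_char r (A j) \<le> r powr b'"
  proof (intro eventually_ball_finite J ballI growth_order_less_imp_char_le)
    fix j assume "j \<in> J"
    thus "growth_order (A j) < ereal b'" using mj[of j] \<mu> b' by (auto intro: le_less_trans)
  qed
  moreover have "\<forall>\<^sub>F r in at_top. ln n + n * r powr b' + (\<Sum>j\<in>J. C j) * r powr (s - \<alpha>) < r powr b"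
    using b' \<alpha> by (intro eventually_sum_powr_less)
  \<comment> \<open>For large \<open>r\<close> outside \<open>E\<close> the equation will force the
    characteristic of \<open>A l\<close> below \<open>r powr b\<close>, whereas the order of
    \<open>A l\<close> makes the opposite inequality frequent outside \<open>E\<close>.\<close>
  ultimately have "\<forall>\<^sub>F r in at_top. \<not> (r powr b < nevanlinna_char r (A l) \<and> r \<notin> E)"
    using eventually_gt_at_top[of 0]
  proof eventually_elim
    case (elim r)
    show ?case
    proof safe
      assume big: "r powr b < nevanlinna_char r (A l)" and "r \<notin> E"
      hence g: "good r" using good by blast
      have cA: "continuous_on S (\<lambda>z. log_plus (norm (A j z)))" if "j \<le> n" for j S
        using holomorphic_on_imp_continuous_on[OF assms(2)[OF that]]
        by (intro continuous_intros) (auto intro: continuous_on_subset)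
      have cf: "continuous_on (sphere 0 r) (\<lambda>z. \<bar>ln (norm (f (z + of_nat j))) - ln (norm (f (z + of_nat l)))\<bar>)"
        if "j \<le> n" for j
        using g that assms(3)
        by (intro continuous_intros continuous_on_ln_norm_shift[OF assms(5) sparse]) (auto simp: good_def)
      have "nevanlinna_char r (A l) = circle_mean r (\<lambda>z. log_plus (norm (A l z)))"
        using assms(2,3) by (intro nevanlinna_char_entire)
      also have "\<dots> \<le> circle_mean r (\<lambda>z. ln n + (\<Sum>j\<in>J. log_plus (norm (A j z)) +
          \<bar>ln (norm (f (z + of_nat j))) - ln (norm (f (z + of_nat l)))\<bar>))"
      proof (rule circle_mean_mono)
        fix z :: complex assume z: "norm z = r"
        have nz: "f (z + of_nat j) \<noteq> 0" if "j \<le> n" for j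
          using g z that by (auto simp: good_def bad_points_def)
        have "(\<Sum>j\<le>n. A j z * f (z + of_nat j)) = A l z * f (z + of_nat l) + (\<Sum>j\<in>J. A j z * f (z + of_nat j))"
          unfolding J_def using assms(3) by (subst sum.remove[of _ l]) auto
        hence "A l z * f (z + of_nat l) = - (\<Sum>j\<in>J. A j z * f (z + of_nat j))"
          using g z by (simp add: good_def eq_neg_iff_add_eq_0)
        \<comment> \<open>Division is legitimate on a good circle, where no shift of
          \<open>f\<close> vanishes. The minus sign goes into the quotients, whose moduli alone
          matter.\<close>
        hence "A l z = - (\<Sum>j\<in>J. A j z * f (z + of_nat j)) / f (z + of_nat l)"
          using nz[OF assms(3)] by (simp add: field_simps)
        also have "\<dots> = (\<Sum>j\<in>J. A j z * (- (f (z + of_nat j) / f (z + of_nat l))))"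
          by (simp add: sum_divide_distrib sum_negf)
        finally have "log_plus (norm (A l z)) \<le> ln n + (\<Sum>j\<in>J. log_plus (norm (A j z)) +
            \<bar>ln (norm (- (f (z + of_nat j) / f (z + of_nat l))))\<bar>)"
          using J assms(1,3) nz by (intro log_plus_sum_le) (auto simp: J_def)
        also have "\<dots> = ln n + (\<Sum>j\<in>J. log_plus (norm (A j z)) +
          \<bar>ln (norm (f (z + of_nat j))) - ln (norm (f (z + of_nat l)))\<bar>)"
          using nz assms(3) by (auto simp: norm_divide ln_div J_def intro!: sum.cong)
        finally show "log_plus (norm (A l z)) \<le> \<dots>" .
      qed (use assms(3) elim in \<open>auto intro!: continuous_on_add continuous_on_sum continuous_on_const cA cf simp: J_def\<close>)
      also have "\<dots> = ln n + (\<Sum>j\<in>J. circle_mean r (\<lambda>z. log_plus (norm (A j z))) + q j r)"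
      proof -
        have J_le: "j \<le> n" if "j \<in> J" for j using that by (simp add: J_def)
        note cont = continuous_on_add continuous_on_sum continuous_on_const cA cf J_le
        have "circle_mean r (\<lambda>z. ln n + (\<Sum>j\<in>J. log_plus (norm (A j z)) +
          \<bar>ln (norm (f (z + of_nat j))) - ln (norm (f (z + of_nat l)))\<bar>)) =
          ln n + circle_mean r (\<lambda>z. \<Sum>j\<in>J. log_plus (norm (A j z)) +
          \<bar>ln (norm (f (z + of_nat j))) - ln (norm (f (z + of_nat l)))\<bar>)"
          using elim by (subst circle_mean_add) (auto intro!: cont)
        also have "circle_mean r (\<lambda>z. \<Sum>j\<in>J. log_plus (norm (A j z)) +
          \<bar>ln (norm (f (z + of_nat j))) - ln (norm (f (z + of_nat l)))\<bar>) =
          (\<Sum>j\<in>J. circle_mean r (\<lambda>z. log_plus (norm (A j z)) +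
          \<bar>ln (norm (f (z + of_nat j))) - ln (norm (f (z + of_nat l)))\<bar>))"
          using elim J(1) by (intro circle_mean_sum) (auto intro!: cont)
        also have "\<dots> = (\<Sum>j\<in>J. circle_mean r (\<lambda>z. log_plus (norm (A j z))) + q j r)"
          unfolding q_def using elim by (intro sum.cong refl circle_mean_add) (auto intro!: cont)
        finally show ?thesis .
      qed
      also have "(\<Sum>j\<in>J. circle_mean r (\<lambda>z. log_plus (norm (A j z))) + q j r)
          \<le> (\<Sum>j\<in>J. r powr b' + C j * r powr (s - \<alpha>))"
      proof (intro sum_mono add_mono)
        fix j assume j: "j \<in> J"
        show "circle_mean r (\<lambda>z. log_plus (norm (A j z))) \<le> r powr b'"
          using bspec[OF elim(2) j] j nevanlinna_char_entire[OF assms(2), of j r] by (simp add: J_def)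
        show "q j r \<le> C j * r powr (s - \<alpha>)" using elim(1) j g by blast
      qed
      also have "\<dots> = n * r powr b' + (\<Sum>j\<in>J. C j) * r powr (s - \<alpha>)"
        using J by (simp add: sum.distrib sum_distrib_right)
      finally show False using big elim(3) by simp
    qed
  qed
  moreover have "\<exists>\<^sub>F r in at_top. r powr b < nevanlinna_char r (A l) \<and> r \<notin> E"
    using assms(2,3) b b' \<open>countable E\<close> by (intro frequently_char_gt_avoiding) auto
  ultimately show False by (simp add: frequently_def)
qed

end
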